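(* Consider Morse polynomials of degree 4 whose degree-4 homogeneous part is non-degenerate and vanishes on four distinct real lines in $\mathbb R^2$. For such a polynomial let $M$ be the number of its critical points in $\mathbb R^2$ and $m_+$ the number of its local maxima. Then the set of pairs $(M,m_+)$ realized by such polynomials is exactly the set of pairs with $M\in\{3,5,7,9\}$ and $0\le m_+<M/2-1$.
   Context: A homogeneous polynomial of degree 4 in $(x,y)$ with real coefficients is called non-degenerate if it is a product of four pairwise non-proportional linear forms over $\mathbb C$. A Morse polynomial of degree 4 is a real polynomial $\mathbb R^2\to\mathbb R$ of degree 4 with non-degenerate degree-4 homogeneous part, all of whose critical points in $\mathbb C^2$ are non-degenerate (there are then exactly 9 of them in $\mathbb C^2$). *)

theory Defs
  imports "HOL-Analysis.Analysis"
begin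

text \<open>A real polynomial of degree at most 4 in two variables is represented by its
  coefficient function c, where c i j is the coefficient of x^i y^j (only i + j \<le> 4 matter).
  Evaluation is available over any real algebra, in particular over the reals and complexes.\<close>

definition peval :: "(nat \<Rightarrow> nat \<Rightarrow> real) \<Rightarrow> 'a::real_algebra_1 \<Rightarrow> 'a \<Rightarrow> 'a" where
  "peval c x y = (\<Sum>i\<le>4. \<Sum>j\<le>4 - i. of_real (c i j) * x ^ i * y ^ j)"

definition top4 :: "(nat \<Rightarrow> nat \<Rightarrow> real) \<Rightarrow> 'a::real_algebra_1 \<Rightarrow> 'a \<Rightarrow> 'a" where
  "top4 c x y = (\<Sum>i\<le>4. of_real (c i (4 - i)) * x ^ i * y ^ (4 - i))"

definition dX :: "(nat \<Rightarrow> nat \<Rightarrow> real) \<Rightarrow> nat \<Rightarrow> nat \<Rightarrow> real" where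
  "dX c i j = (if i + j \<le> 3 then real (i + 1) * c (i + 1) j else 0)"

definition dY :: "(nat \<Rightarrow> nat \<Rightarrow> real) \<Rightarrow> nat \<Rightarrow> nat \<Rightarrow> real" where
  "dY c i j = (if i + j \<le> 3 then real (j + 1) * c i (j + 1) else 0)"

definition nondegenerate4 :: "(nat \<Rightarrow> nat \<Rightarrow> real) \<Rightarrow> bool" where
  "nondegenerate4 c \<longleftrightarrow>
     (\<exists>a b :: nat \<Rightarrow> complex.
        (\<forall>x y :: complex. top4 c x y = (\<Prod>k<4. a k * x + b k * y)) \<and>
        (\<forall>k<4. \<forall>l<4. k \<noteq> l \<longrightarrow> a k * b l \<noteq> a l * b k))"

definition crit :: "(nat \<Rightarrow> nat \<Rightarrow> real) \<Rightarrow> 'a::real_algebra_1 \<Rightarrow> 'a \<Rightarrow> bool" where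
  "crit c x y \<longleftrightarrow> peval (dX c) x y = 0 \<and> peval (dY c) x y = 0"

definition hessdet :: "(nat \<Rightarrow> nat \<Rightarrow> real) \<Rightarrow> 'a::{real_algebra_1,comm_ring_1} \<Rightarrow> 'a \<Rightarrow> 'a" where
  "hessdet c x y = peval (dX (dX c)) x y * peval (dY (dY c)) x y
                   - peval (dX (dY c)) x y * peval (dY (dX c)) x y"

definition morse4 :: "(nat \<Rightarrow> nat \<Rightarrow> real) \<Rightarrow> bool" where
  "morse4 c \<longleftrightarrow> nondegenerate4 c \<and>
     (\<forall>x y :: complex. crit c x y \<longrightarrow> hessdet c x y \<noteq> 0)"

definition four_real_lines :: "(nat \<Rightarrow> nat \<Rightarrow> real) \<Rightarrow> bool" where
  "four_real_lines c \<longleftrightarrow>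
     (\<exists>a b d :: nat \<Rightarrow> real.
        (\<forall>k<4. (a k, b k) \<noteq> (0, 0)) \<and>
        (\<forall>k<4. \<forall>l<4. k \<noteq> l \<longrightarrow>
            {(x, y). a k * x + b k * y = d k} \<noteq> {(x, y). a l * x + b l * y = d l}) \<and>
        (\<forall>k<4. \<forall>x y :: real. a k * x + b k * y = d k \<longrightarrow> top4 c x y = 0))"

definition real_crits :: "(nat \<Rightarrow> nat \<Rightarrow> real) \<Rightarrow> (real \<times> real) set" where
  "real_crits c = {(x, y). crit c x y}"

definition local_maxima :: "(nat \<Rightarrow> nat \<Rightarrow> real) \<Rightarrow> (real \<times> real) set" where
  "local_maxima c = {z. \<exists>e>0. \<forall>w. dist w z < e \<longrightarrow>
                        peval c (fst w) (snd w) \<le> peval c (fst z) (snd z)}"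

end

theory Submission
  imports Defs "HOL-Computational_Algebra.Computational_Algebra" "HOL-Computational_Algebra.Field_as_Ring"
begin

text \<open>Let \<open>f\<close> be such a polynomial and \<open>J\<close> its Hessian determinant. The Bezoutian of the two cubics
  \<open>f\<^sub>x\<close>, \<open>f\<^sub>y\<close> vanishes at pairs of distinct critical points and equals \<open>J\<close> on the diagonal, so on
  real (conjugation-symmetric) weights on the critical points it is a diagonal form with signs
  those of \<open>J\<close> at real points and one plus and one minus for each conjugate pair. It has total
  degree 4, so on weights whose moments of degree at most 1 vanish (three conditions) it only
  depends on the second moments, through a form that is minus a sum of squares when the top part
  of \<open>f\<close> splits into real lines; it vanishes when the second moments vanish as well (six
  conditions). Hence there are at most 3 plus signs and at most 6 minus signs. By a Nullstellensatz
  argument the simple common zeros of \<open>f\<^sub>x\<close>, \<open>f\<^sub>y\<close> in the complex plane number at least 9, so both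
  bounds are attained: with \<open>n\<close> extrema there are \<open>n + 3\<close> saddles and \<open>n \<le> 3\<close>. All cases are realised by
  a family of quartics symmetric in \<open>y\<close> together with the symmetry \<open>f \<mapsto> - f\<close>, which exchanges
  maxima and minima.\<close>

section \<open>Linear systems and binary forms\<close>

text \<open>The bounds 3 and 6 reflect the Hilbert function 1, 2, 3, 2, 1 of the algebra of the two
  leading cubic forms: degrees 0 and 1 pair hyperbolically with degrees 4 and 3, which gives
  signature (3, 3), and the middle degree contributes three minus signs when the leading form splits
  over the reals. Weights on the points replace this algebra by moment conditions, so that only
  linear algebra and one identity between squares remain.

  Neither finiteness of the critical set nor the upper bound of Bezout's theorem is presupposed:
  both inequalities are proved for finite sets of critical points and imply finiteness. Only the
  lower bound has to be supplied; it is 9 = 15 - 6, the 15 monomials of degree at most 4 against the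
  6 products of the two cubics with 1, x, y.

  Negation sends m maxima among n extrema to n - m. As n \<le> 3, one of m and n - m is at most 1,
  so a family with at most one local maximum covers all cases.\<close>

lemma homogeneous_system_nontrivial:
  fixes a :: "'e \<Rightarrow> 'k \<Rightarrow> 'f::field"
  assumes "finite E" "finite K" "card E < card K"
  shows "\<exists>u. (\<exists>k\<in>K. u k \<noteq> 0) \<and> (\<forall>e\<in>E. (\<Sum>k\<in>K. a e k * u k) = 0)"
  using assms
proof (induction E arbitrary: K a rule: finite_induct)
  case empty
  then have "K \<noteq> {}" by auto
  then show ?case by (intro exI[of _ "\<lambda>_. 1"]) auto
next
  case (insert e E)
  show ?case
  proof (cases "\<forall>k\<in>K. a e k = 0")
    case True
    have "card E < card K" using insert by simp
    from insert.IH[OF insert.prems(1) this] obtain u where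
      "\<exists>k\<in>K. u k \<noteq> 0" "\<forall>e\<in>E. (\<Sum>k\<in>K. a e k * u k) = 0" by blast
    with True show ?thesis by (intro exI[of _ u]) auto
  next
    case False
    then obtain k0 where k0: "k0 \<in> K" "a e k0 \<noteq> 0" by blast
    define K' where "K' = K - {k0}"
    have fK': "finite K'" and cK': "card E < card K'"
      using insert k0 by (auto simp: K'_def)
    \<comment> \<open>Gaussian elimination: the pivot \<open>k0\<close> is cleared from the other
      equations, and its value is recovered afterwards from the equation \<open>e\<close>.\<close>
    define a' where "a' = (\<lambda>e' k. a e' k - a e' k0 * a e k / a e k0)"
    from insert.IH[OF fK' cK', of a'] obtain u where
      u: "\<exists>k\<in>K'. u k \<noteq> 0" "\<forall>e\<in>E. (\<Sum>k\<in>K'. a' e k * u k) = 0" by blast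
    define S where "S = (\<Sum>k\<in>K'. a e k * u k)"
    define u' where "u' = u(k0 := - S / a e k0)"
    have split: "(\<Sum>k\<in>K. a f k * u' k) = (\<Sum>k\<in>K'. a f k * u k) - a f k0 * S / a e k0" for f
    proof -
      have "(\<Sum>k\<in>K. a f k * u' k) = a f k0 * u' k0 + (\<Sum>k\<in>K'. a f k * u' k)"
        unfolding K'_def using k0 insert.prems(1) by (simp add: sum.remove)
      also have "(\<Sum>k\<in>K'. a f k * u' k) = (\<Sum>k\<in>K'. a f k * u k)"
        by (rule sum.cong) (auto simp: u'_def K'_def)
      finally show ?thesis by (simp add: u'_def)
    qed
    have "(\<Sum>k\<in>K. a f k * u' k) = 0" if "f \<in> E" for f
    proof -
      have "0 = (\<Sum>k\<in>K'. a' f k * u k)" using u(2) that by simp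
      also have "\<dots> = (\<Sum>k\<in>K'. a f k * u k) - a f k0 * S / a e k0"
        by (simp add: a'_def S_def algebra_simps sum_subtractf sum_distrib_left sum_divide_distrib)
      finally show ?thesis using split by simp
    qed
    moreover have "(\<Sum>k\<in>K. a e k * u' k) = 0"
      using split[of e] k0 by (simp add: S_def)
    moreover have "\<exists>k\<in>K. u' k \<noteq> 0"
      using u(1) by (auto simp: u'_def K'_def)
    ultimately show ?thesis by (intro exI[of _ u']) auto
  qed
qed

section \<open>Binary forms as homogenised univariate polynomials\<close>

text \<open>The homogenisation of \<open>p\<close> in formal degree \<open>n\<close>. Univariate
  polynomials carry Bezout coefficients and a division algorithm, so questions on binary forms can
  be settled there; the price is that a zero at infinity shows up only as a drop of
  \<open>degree p\<close> below \<open>n\<close>.\<close>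

definition form :: "nat \<Rightarrow> 'a::comm_ring_1 poly \<Rightarrow> 'a \<Rightarrow> 'a \<Rightarrow> 'a" where
  "form n p x y = (\<Sum>i\<le>n. coeff p i * x ^ i * y ^ (n - i))"

lemma form_0 [simp]: "form n 0 x y = 0"
  by (simp add: form_def)

lemma form_add: "form n (p + q) x y = form n p x y + form n q x y"
  by (simp add: form_def algebra_simps sum.distrib)

lemma form_minus: "form n (- p) x y = - form n p x y"
  by (simp add: form_def sum_negf)

lemma form_smult: "form n (smult c p) x y = c * form n p x y"
  by (simp add: form_def sum_distrib_left mult.assoc)

lemma form_homogeneous: "form n p (t * x) (t * y) = t ^ n * form n p x y"
  unfolding form_def sum_distrib_left
proof (rule sum.cong)
  fix i assume "i \<in> {..n}"
  then have "t ^ n = t ^ i * t ^ (n - i)" by (simp flip: power_add)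
  then show "coeff p i * (t * x) ^ i * (t * y) ^ (n - i) = t ^ n * (coeff p i * x ^ i * y ^ (n - i))"
    by (simp add: power_mult_distrib)
qed simp

lemma form_0_right: "form n p x 0 = coeff p n * x ^ n"
proof -
  have "form n p x 0 = (\<Sum>i\<in>{n}. coeff p i * x ^ i * 0 ^ (n - i))"
    unfolding form_def by (rule sum.mono_neutral_right) (auto simp: power_0_left)
  then show ?thesis by simp
qed

lemma form_eq_poly:
  fixes y :: "'a::field"
  assumes "degree p \<le> n" "y \<noteq> 0"
  shows "form n p x y = y ^ n * poly p (x / y)"
proof -
  have "poly p (x / y) = (\<Sum>i\<le>n. coeff p i * (x / y) ^ i)"
    using assms(1) by (rule poly_as_sum_of_monoms'[THEN arg_cong[where f = "\<lambda>p. poly p (x / y)"], simplified poly_sum poly_monom, symmetric])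
  then show ?thesis
    unfolding form_def using assms(2)
    by (auto simp: sum_distrib_left power_divide power_diff field_simps intro!: sum.cong)
qed

lemma coeff_mult_bounded:
  fixes p q :: "'a::comm_ring_1 poly"
  assumes "degree p \<le> m" "degree q \<le> n"
  shows "coeff (p * q) (m + n) = coeff p m * coeff q n"
proof (cases "degree p = m \<and> degree q = n")
  case True
  then show ?thesis using coeff_mult_degree_sum[of p q] by auto
next
  case False
  then have "degree p < m \<or> degree q < n" using assms by auto
  moreover from this have "degree (p * q) < m + n"
    using degree_mult_le[of p q] assms by linarith
  ultimately show ?thesis by (auto simp: coeff_eq_0)
qed

text \<open>For y \<noteq> 0 this is multiplicativity of evaluation at x / y. On y = 0 only the
  coefficients at the formal degrees survive, and these multiply even when they vanish.\<close>

lemma form_mult: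
  fixes p q :: "'a::field poly"
  assumes "degree p \<le> m" "degree q \<le> n"
  shows "form (m + n) (p * q) x y = form m p x y * form n q x y"
proof (cases "y = 0")
  case True
  then show ?thesis
    using coeff_mult_bounded[OF assms] by (simp add: form_0_right power_add)
next
  case False
  have "degree (p * q) \<le> m + n"
    using degree_mult_le[of p q] assms by linarith
  then show ?thesis
    using False assms by (simp add: form_eq_poly power_add)
qed

lemma form_Suc:
  assumes "degree p \<le> n"
  shows "form (Suc n) p x y = y * form n p x y"
  using assms unfolding form_def
  by (auto simp: sum_distrib_left coeff_eq_0 Suc_diff_le algebra_simps intro!: sum.cong)

lemma form_1: "form (Suc 0) p x y = coeff p 0 * y + coeff p 1 * x"
  by (simp add: form_def)

text \<open>Projective zeros (u k : v k) are split off one at a time, beginning with the last;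
  pairwise independence passes the other zeros on to the cofactor.\<close>

lemma form_vanishing_factor:
  fixes u v :: "nat \<Rightarrow> 'a::field"
  assumes "degree p \<le> n"
    and "\<And>k. k < n \<Longrightarrow> form n p (u k) (v k) = 0"
    and "\<And>k. k < n \<Longrightarrow> u k \<noteq> 0 \<or> v k \<noteq> 0"
    and "\<And>k l. k < n \<Longrightarrow> l < n \<Longrightarrow> k \<noteq> l \<Longrightarrow> u k * v l \<noteq> u l * v k"
  shows "\<exists>c. \<forall>x y. form n p x y = c * (\<Prod>k<n. v k * x - u k * y)"
  using assms
proof (induction n arbitrary: p)
  case 0
  then show ?case by (auto simp: form_def)
next
  case (Suc n)
  obtain q where q: "degree q \<le> n"
    "\<And>x y. form (Suc n) p x y = (v n * x - u n * y) * form n q x y"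
  \<comment> \<open>For v n = 0 the zero is the point at infinity. There is no root of
    \<open>p\<close> to divide by, but the top coefficient vanishes, and the cofactor is
    \<open>p\<close> itself, up to a scalar, in lower formal degree.\<close>
  proof (cases "v n = 0")
    case True
    with Suc.prems(3)[of n] have "u n \<noteq> 0" by auto
    with True Suc.prems(2)[of n] have "coeff p (Suc n) = 0" by (simp add: form_0_right)
    then have "degree p \<le> n"
      using Suc.prems(1) by (metis le_Suc_eq leading_coeff_0_iff degree_0 zero_le)
    then show ?thesis
      using that[of "smult (- 1 / u n) p"] True \<open>u n \<noteq> 0\<close> form_Suc[of p n]
      by (simp add: form_smult form_minus)
  next
    case False
    with Suc.prems(1) Suc.prems(2)[of n] have "poly p (u n / v n) = 0" by (auto simp: form_eq_poly)
    then obtain r where r: "p = [:- (u n / v n), 1:] * r"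
      using dvdE poly_eq_0_iff_dvd by blast
    then have "p = [:- u n, v n:] * smult (1 / v n) r" (is "_ = ?l * ?q")
      using False by (auto simp: field_simps smult_add_right)
    moreover have "degree ?q \<le> n"
    proof (cases "r = 0")
      case False
      then have "degree p = Suc (degree r)"
        unfolding r by (subst degree_mult_eq) auto
      then show ?thesis using Suc.prems(1) by (simp add: le_trans[OF degree_smult_le])
    qed simp
    moreover have "form (Suc 0 + n) (?l * ?q) x y = (v n * x - u n * y) * form n ?q x y" for x y
      using \<open>degree ?q \<le> n\<close> by (subst form_mult) (auto simp: form_1 algebra_simps)
    ultimately show ?thesis using that[of ?q] by simp
  qed
  have "form n q (u k) (v k) = 0" if "k < n" for k
    using Suc.prems(2)[of k] Suc.prems(4)[of k n] q(2) that by (auto simp: mult.commute)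
  with Suc.IH[of q] q(1) Suc.prems(3,4) obtain c where
    "\<forall>x y. form n q x y = c * (\<Prod>k<n. v k * x - u k * y)" by (meson less_SucI)
  with q(2) show ?case by (auto simp: mult_ac)
qed

section \<open>Polynomial functions in two variables\<close>

text \<open>Polynomials of degree at most \<open>n\<close> are taken as functions, presented by
  homogeneous components so that leading forms are at hand; in characteristic 0 the components are
  unique by \<open>forms_independent\<close>.\<close>

definition poly_fun :: "nat \<Rightarrow> ('a::field \<Rightarrow> 'a \<Rightarrow> 'a) set" where
  "poly_fun n = {f. \<exists>p. (\<forall>k\<le>n. degree (p k) \<le> k) \<and> (\<forall>x y. f x y = (\<Sum>k\<le>n. form k (p k) x y))}"

lemma poly_fun_zero [simp]: "(\<lambda>x y. 0) \<in> poly_fun n"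
  unfolding poly_fun_def by (auto intro!: exI[of _ "\<lambda>_. 0"])

lemma poly_fun_add:
  assumes "f \<in> poly_fun n" "g \<in> poly_fun n"
  shows "(\<lambda>x y. f x y + g x y) \<in> poly_fun n"
proof -
  obtain p q where "\<forall>k\<le>n. degree (p k) \<le> k" "\<forall>x y. f x y = (\<Sum>k\<le>n. form k (p k) x y)"
    "\<forall>k\<le>n. degree (q k) \<le> k" "\<forall>x y. g x y = (\<Sum>k\<le>n. form k (q k) x y)"
    using assms unfolding poly_fun_def by blast
  then show ?thesis unfolding poly_fun_def
    by (auto intro!: exI[of _ "\<lambda>k. p k + q k"] degree_add_le simp: form_add sum.distrib)
qed

lemma poly_fun_sum:
  assumes "\<And>i. i \<in> I \<Longrightarrow> f i \<in> poly_fun n"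
  shows "(\<lambda>x y. \<Sum>i\<in>I. f i x y) \<in> poly_fun n"
  using assms by (induction I rule: infinite_finite_induct) (auto intro: poly_fun_add)

lemma form_in_poly_fun:
  assumes "degree p \<le> k" "k \<le> n"
  shows "form k p \<in> poly_fun n"
proof -
  have "form k p x y = (\<Sum>j\<le>n. form j (if j = k then p else 0) x y)" for x y
  proof -
    have "(\<Sum>j\<le>n. form j (if j = k then p else 0) x y) = (\<Sum>j\<le>n. if j = k then form k p x y else 0)"
      by (rule sum.cong) auto
    then show ?thesis using assms by simp
  qed
  then show ?thesis unfolding poly_fun_def using assms
    by (intro CollectI exI[of _ "\<lambda>j. if j = k then p else 0"]) auto
qed

lemma poly_fun_mono:
  assumes "f \<in> poly_fun m" "m \<le> n"
  shows "f \<in> poly_fun n"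
proof -
  obtain p where p: "\<And>k. k\<le>m \<Longrightarrow> degree (p k) \<le> k" "\<And>x y. f x y = (\<Sum>k\<le>m. form k (p k) x y)"
    using assms(1) unfolding poly_fun_def by blast
  have "(\<lambda>x y. \<Sum>k\<le>m. form k (p k) x y) \<in> poly_fun n"
    using p(1) assms(2) by (intro poly_fun_sum form_in_poly_fun) auto
  then show ?thesis using p(2) by presburger
qed

lemma poly_fun_const: "(\<lambda>x y. c) \<in> poly_fun n"
  using form_in_poly_fun[of "[:c:]" 0 n] by (simp add: form_def[abs_def])

lemma poly_fun_fst: "0 < n \<Longrightarrow> (\<lambda>x y. x) \<in> poly_fun n"
  using form_in_poly_fun[of "[:0, 1:]" 1 n] by (simp add: form_def[abs_def])

lemma poly_fun_snd: "0 < n \<Longrightarrow> (\<lambda>x y. y) \<in> poly_fun n"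
  using form_in_poly_fun[of "[:1:]" 1 n] by (simp add: form_def[abs_def])

lemma poly_fun_mult:
  assumes "f \<in> poly_fun m" "g \<in> poly_fun n"
  shows "(\<lambda>x y. f x y * g x y) \<in> poly_fun (m + n)"
proof -
  obtain p where p: "\<And>k. k\<le>m \<Longrightarrow> degree (p k) \<le> k" "\<And>x y. f x y = (\<Sum>k\<le>m. form k (p k) x y)"
    using assms(1) unfolding poly_fun_def by blast
  obtain q where q: "\<And>k. k\<le>n \<Longrightarrow> degree (q k) \<le> k" "\<And>x y. g x y = (\<Sum>k\<le>n. form k (q k) x y)"
    using assms(2) unfolding poly_fun_def by blast
  have "f x y * g x y = (\<Sum>k\<le>m. \<Sum>l\<le>n. form (k + l) (p k * q l) x y)" for x y
    unfolding p(2) q(2) sum_product using p(1) q(1) by (intro sum.cong) (auto simp: form_mult)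
  moreover have "(\<lambda>x y. \<Sum>k\<le>m. \<Sum>l\<le>n. form (k + l) (p k * q l) x y) \<in> poly_fun (m + n)"
    using p(1) q(1) by (intro poly_fun_sum form_in_poly_fun)
      (auto intro!: order.trans[OF degree_mult_le] add_mono)
  ultimately show ?thesis by presburger
qed

lemma poly_fun_cmult: "f \<in> poly_fun n \<Longrightarrow> (\<lambda>x y. c * f x y) \<in> poly_fun n"
  using poly_fun_mult[OF poly_fun_const[of c 0], of f n] by simp

lemma poly_fun_uminus: "f \<in> poly_fun n \<Longrightarrow> (\<lambda>x y. - f x y) \<in> poly_fun n"
  using poly_fun_cmult[of f n "- 1"] by simp

lemma poly_fun_diff:
  "f \<in> poly_fun n \<Longrightarrow> g \<in> poly_fun n \<Longrightarrow> (\<lambda>x y. f x y - g x y) \<in> poly_fun n"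
  using poly_fun_add[of f n "\<lambda>x y. - g x y"] poly_fun_uminus[of g n] by simp

lemma poly_fun_Suc_cases:
  assumes "f \<in> poly_fun (Suc n)"
  obtains p g where "degree p \<le> Suc n" "g \<in> poly_fun n" "\<And>x y. f x y = form (Suc n) p x y + g x y"
proof -
  obtain p where p: "\<forall>k\<le>Suc n. degree (p k) \<le> k" "\<And>x y. f x y = (\<Sum>k\<le>Suc n. form k (p k) x y)"
    using assms unfolding poly_fun_def by blast
  from p(1) have "(\<lambda>x y. \<Sum>k\<le>n. form k (p k) x y) \<in> poly_fun n"
    unfolding poly_fun_def by (auto intro!: exI[of _ p])
  then show ?thesis using that[of "p (Suc n)" "\<lambda>x y. \<Sum>k\<le>n. form k (p k) x y"] p by simp
qed

text \<open>On a line through the origin the sum is a polynomial in the parameter t whose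
  coefficients are the values of the components. It vanishes identically, and setting y = 1 recovers
  each \<open>p k\<close>.\<close>

lemma forms_independent:
  fixes p :: "nat \<Rightarrow> 'a::field_char_0 poly"
  assumes "\<And>k. k \<le> n \<Longrightarrow> degree (p k) \<le> k"
    and zero: "\<And>x y. (\<Sum>k\<le>n. form k (p k) x y) = 0" and "k \<le> n"
  shows "p k = 0"
proof -
  have "form k (p k) x y = 0" for x y
  proof -
    let ?r = "\<Sum>k\<le>n. monom (form k (p k) x y) k"
    have "poly ?r t = 0" for t
      using zero[of "t * x" "t * y"]
      by (simp add: poly_sum poly_monom form_homogeneous mult.commute)
    then have "?r = 0" by (simp add: poly_all_0_iff_0[symmetric])
    then have "coeff ?r k = 0" by simp
    then show ?thesis using \<open>k \<le> n\<close> by (simp add: coeff_sum if_distrib cong: if_cong)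
  qed
  then have "poly (p k) x = 0" for x
    using form_eq_poly[of "p k" k 1 x] assms(1)[OF \<open>k \<le> n\<close>] by simp
  then show ?thesis by (simp add: poly_all_0_iff_0[symmetric])
qed

text \<open>The descent in \<open>reduce_coefficients\<close> extracts its relation between leading
  forms from this comparison of degrees.\<close>

lemma form_Suc_in_poly_fun:
  fixes p :: "'a::field_char_0 poly"
  assumes "form (Suc n) p \<in> poly_fun n" "degree p \<le> Suc n"
  shows "p = 0"
proof -
  obtain q where q: "\<And>k. k\<le>n \<Longrightarrow> degree (q k) \<le> k" "\<And>x y. form (Suc n) p x y = (\<Sum>k\<le>n. form k (q k) x y)"
    using assms(1) unfolding poly_fun_def by blast
  define r where "r = q(Suc n := - p)"
  have "r (Suc n) = 0"
  proof (rule forms_independent)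
    fix x y
    have "(\<Sum>k\<le>n. form k (r k) x y) = (\<Sum>k\<le>n. form k (q k) x y)"
      by (rule sum.cong) (auto simp: r_def)
    then show "(\<Sum>k\<le>Suc n. form k (r k) x y) = 0"
      using q(2)[of x y] by (simp add: r_def form_minus)
  qed (use q(1) assms(2) in \<open>auto simp: r_def\<close>)
  then show ?thesis by (simp add: r_def)
qed

text \<open>The index \<open>(k, i)\<close> stands for the monomial $x^i y^{k-i}$ of degree \<open>k\<close>.\<close>

definition mons :: "nat \<Rightarrow> (nat \<times> nat) set" where
  "mons n = (SIGMA k:{..n}. {..k})"

definition mon :: "nat \<times> nat \<Rightarrow> 'a::field \<Rightarrow> 'a \<Rightarrow> 'a" where
  "mon e x y = x ^ snd e * y ^ (fst e - snd e)"

lemma finite_mons [simp]: "finite (mons n)"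
  by (simp add: mons_def)

lemma card_mons_4: "card (mons 4) = 15"
  by (simp add: mons_def card_SigmaI eval_nat_numeral)

lemma sum_mons: "(\<Sum>e\<in>mons n. u e * mon e x y) = (\<Sum>k\<le>n. \<Sum>i\<le>k. u (k, i) * x ^ i * y ^ (k - i))"
  unfolding mons_def by (subst sum.Sigma) (auto simp: mon_def mult.assoc intro!: sum.cong)

lemma poly_fun_mons:
  assumes "f \<in> poly_fun n"
  shows "\<exists>u. \<forall>x y. f x y = (\<Sum>e\<in>mons n. u e * mon e x y)"
proof -
  obtain p where "\<And>x y. f x y = (\<Sum>k\<le>n. form k (p k) x y)"
    using assms unfolding poly_fun_def by blast
  then show ?thesis
    by (intro exI[of _ "\<lambda>(k, i). coeff (p k) i"]) (simp add: sum_mons form_def)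
qed

lemma sum_mons_eq_forms:
  "(\<Sum>e\<in>mons n. u e * mon e x y) = (\<Sum>k\<le>n. form k (\<Sum>i\<le>k. monom (u (k, i)) i) x y)"
  unfolding sum_mons form_def by (auto simp: coeff_sum intro!: sum.cong)

lemma degree_sum_monom_le: "degree (\<Sum>i\<le>k. monom (u i) i) \<le> k"
  by (intro degree_sum_le) (auto intro: order.trans[OF degree_monom_le])

lemma sum_mons_in_poly_fun: "(\<lambda>x y. \<Sum>e\<in>mons n. u e * mon e x y) \<in> poly_fun n"
  unfolding sum_mons_eq_forms by (intro poly_fun_sum form_in_poly_fun degree_sum_monom_le) simp

lemma mons_independent:
  fixes u :: "nat \<times> nat \<Rightarrow> 'a::field_char_0"
  assumes "\<And>x y. (\<Sum>e\<in>mons n. u e * mon e x y) = 0" "e \<in> mons n"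
  shows "u e = 0"
proof -
  obtain k i where e: "e = (k, i)" "k \<le> n" "i \<le> k" using assms(2) by (auto simp: mons_def)
  have "(\<Sum>i\<le>k. monom (u (k, i)) i) = 0"
    by (rule forms_independent[where n = n]) (use assms(1) e degree_sum_monom_le in \<open>auto simp: sum_mons_eq_forms\<close>)
  then have "coeff (\<Sum>i\<le>k. monom (u (k, i)) i) i = 0" by simp
  then show ?thesis using e by (simp add: coeff_sum)
qed

section \<open>Polynomials of arbitrary degree and common zeros of ideals\<close>

definition poly_funs :: "('a::field \<Rightarrow> 'a \<Rightarrow> 'a) set" where
  "poly_funs = (\<Union>n. poly_fun n)"

lemma poly_funsI: "f \<in> poly_fun n \<Longrightarrow> f \<in> poly_funs"
  by (auto simp: poly_funs_def)

lemma poly_funs_common_degree: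
  assumes "f \<in> poly_funs" "g \<in> poly_funs"
  obtains n where "f \<in> poly_fun n" "g \<in> poly_fun n"
proof -
  obtain k l where "f \<in> poly_fun k" "g \<in> poly_fun l" using assms by (auto simp: poly_funs_def)
  then show ?thesis using that[of "max k l"] by (meson max.cobounded1 max.cobounded2 poly_fun_mono)
qed

lemma poly_funs_const [simp]: "(\<lambda>x y. c) \<in> poly_funs"
  by (rule poly_funsI[OF poly_fun_const[of _ 0]])

lemma poly_funs_fst [simp]: "(\<lambda>x y. x) \<in> poly_funs"
  by (rule poly_funsI[OF poly_fun_fst[of 1]]) simp

lemma poly_funs_snd [simp]: "(\<lambda>x y. y) \<in> poly_funs"
  by (rule poly_funsI[OF poly_fun_snd[of 1]]) simp

lemma poly_funs_add [simp]:
  "f \<in> poly_funs \<Longrightarrow> g \<in> poly_funs \<Longrightarrow> (\<lambda>x y. f x y + g x y) \<in> poly_funs"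
  by (erule (1) poly_funs_common_degree) (erule (1) poly_funsI[OF poly_fun_add])

lemma poly_funs_diff [simp]:
  "f \<in> poly_funs \<Longrightarrow> g \<in> poly_funs \<Longrightarrow> (\<lambda>x y. f x y - g x y) \<in> poly_funs"
  by (erule (1) poly_funs_common_degree) (erule (1) poly_funsI[OF poly_fun_diff])

lemma poly_funs_mult [simp]:
  "f \<in> poly_funs \<Longrightarrow> g \<in> poly_funs \<Longrightarrow> (\<lambda>x y. f x y * g x y) \<in> poly_funs"
  by (erule (1) poly_funs_common_degree) (erule (1) poly_funsI[OF poly_fun_mult])

lemma poly_funs_minus [simp]: "f \<in> poly_funs \<Longrightarrow> (\<lambda>x y. - f x y) \<in> poly_funs"
  using poly_funs_diff[of "\<lambda>x y. 0" f] by simp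

lemma poly_funs_divide [simp]: "f \<in> poly_funs \<Longrightarrow> (\<lambda>x y. f x y / c) \<in> poly_funs"
  using poly_funs_mult[of f "\<lambda>x y. 1 / c"] by simp

lemma poly_funs_sum [simp]:
  "(\<And>i. i \<in> I \<Longrightarrow> f i \<in> poly_funs) \<Longrightarrow> (\<lambda>x y. \<Sum>i\<in>I. f i x y) \<in> poly_funs"
  by (induction I rule: infinite_finite_induct) auto

lemma poly_funs_power [simp]: "f \<in> poly_funs \<Longrightarrow> (\<lambda>x y. f x y ^ n) \<in> poly_funs"
  by (induction n) auto

lemma poly_funs_poly [simp]: "f \<in> poly_funs \<Longrightarrow> (\<lambda>x y. poly q (f x y)) \<in> poly_funs"
  by (induction q) auto

text \<open>Hadamard's lemma: a polynomial differs from its value at (a, b) by an element of the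
  maximal ideal of that point. It is checked monomial by monomial from the factorisations of x^i -
  a^i and y^j - b^j.\<close>

lemma poly_funs_taylor:
  assumes "f \<in> poly_funs"
  obtains g h where "g \<in> poly_funs" "h \<in> poly_funs"
    "\<And>x y. f x y = f a b + (x - a) * g x y + (y - b) * h x y"
proof -
  obtain n where "f \<in> poly_fun n" using assms by (auto simp: poly_funs_def)
  then obtain u where u: "\<And>x y. f x y = (\<Sum>e\<in>mons n. u e * mon e x y)"
    using poly_fun_mons[of f n] by auto
  have "\<exists>g h. g \<in> poly_funs \<and> h \<in> poly_funs \<and>
      (\<forall>x y. (\<Sum>e\<in>A. u e * mon e x y) = (\<Sum>e\<in>A. u e * mon e a b) + (x - a) * g x y + (y - b) * h x y)"
    if "finite A" for A
    using that
  proof induction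
    case empty
    show ?case by (intro exI[of _ "\<lambda>_ _. 0"]) auto
  next
    case (insert e A)
    then obtain g h where gh: "g \<in> poly_funs" "h \<in> poly_funs"
      "\<And>x y. (\<Sum>e\<in>A. u e * mon e x y) = (\<Sum>e\<in>A. u e * mon e a b) + (x - a) * g x y + (y - b) * h x y"
      by blast
    define i j where "i = snd e" and "j = fst e - snd e"
    have p: "x ^ n = a ^ n + (x - a) * (\<Sum>k<n. x ^ k * a ^ (n - Suc k))" for x a :: 'a and n
      using diff_power_eq_sum[of x _ a] power_diff_sumr2[of x n a] by (simp add: algebra_simps)
    \<comment> \<open>The telescoping X Y - A B = (X - A) Y + A (Y - B).\<close>
    have prod_split: "X * Y = A * B + (x - a) * (S * Y) + (y - b) * (A * T)"
      if "X = A + (x - a) * S" "Y = B + (y - b) * T" for X Y A B S T x y :: 'a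
      unfolding that by (simp add: algebra_simps)
    let ?g = "\<lambda>x y. g x y + u e * (\<Sum>k<i. x ^ k * a ^ (i - Suc k)) * y ^ j"
    let ?h = "\<lambda>x y. h x y + u e * a ^ i * (\<Sum>k<j. y ^ k * b ^ (j - Suc k))"
    have e1: "x ^ i * y ^ j = a ^ i * b ^ j + (x - a) * ((\<Sum>k<i. x ^ k * a ^ (i - Suc k)) * y ^ j)
        + (y - b) * (a ^ i * (\<Sum>k<j. y ^ k * b ^ (j - Suc k)))" for x y
      using prod_split[OF p[of x i a] p[of y j b]] .
    have e2: "u e * mon e x y = u e * mon e a b
        + (x - a) * (u e * (\<Sum>k<i. x ^ k * a ^ (i - Suc k)) * y ^ j)
        + (y - b) * (u e * a ^ i * (\<Sum>k<j. y ^ k * b ^ (j - Suc k)))" for x y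
      unfolding mon_def j_def[symmetric] unfolding i_def[symmetric] by (subst e1[of x y]) (simp add: algebra_simps)
    have "(\<Sum>e\<in>insert e A. u e * mon e x y)
        = (\<Sum>e\<in>insert e A. u e * mon e a b) + (x - a) * ?g x y + (y - b) * ?h x y" for x y
      unfolding sum.insert[OF insert.hyps]
      by (subst gh(3)[of x y], subst e2[of x y]) (simp add: algebra_simps)
    moreover have "?g \<in> poly_funs" "?h \<in> poly_funs" using gh(1,2) by simp_all
    ultimately show ?case by blast
  qed
  from this[OF finite_mons[of n]] obtain g h where gh: "g \<in> poly_funs" "h \<in> poly_funs"
    "\<forall>x y. (\<Sum>e\<in>mons n. u e * mon e x y) = (\<Sum>e\<in>mons n. u e * mon e a b) + (x - a) * g x y + (y - b) * h x y"
    by (elim exE conjE)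
  show ?thesis by (rule that[OF gh(1,2)], unfold u) (rule gh(3)[rule_format])
qed

text \<open>The step of the weak Nullstellensatz that fixes one coordinate.\<close>

lemma ideal_adjoin_root:
  fixes K :: "(complex \<Rightarrow> complex \<Rightarrow> complex) set"
  assumes add: "\<And>f g. f \<in> K \<Longrightarrow> g \<in> K \<Longrightarrow> (\<lambda>x y. f x y + g x y) \<in> K"
    and mult: "\<And>f g. f \<in> K \<Longrightarrow> g \<in> poly_funs \<Longrightarrow> (\<lambda>x y. f x y * g x y) \<in> K"
    and proper: "(\<lambda>x y. 1) \<notin> K"
    and v: "v \<in> poly_funs" and q: "q \<noteq> 0" "(\<lambda>x y. poly q (v x y)) \<in> K"
  shows "\<exists>c. \<forall>k\<in>K. \<forall>r\<in>poly_funs. \<exists>x y. k x y + (v x y - c) * r x y \<noteq> 1"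
proof -
  \<comment> \<open>The constant \<open>c\<close> will be a root of the minimal polynomial of
    \<open>v\<close> modulo \<open>K\<close>. If \<open>K\<close> and v - c generated 1, multiplying
    by p / (v - c) would put a polynomial in \<open>v\<close> of smaller degree into
    \<open>K\<close>.\<close>
  obtain p where p: "p \<noteq> 0" "(\<lambda>x y. poly p (v x y)) \<in> K"
    and min: "\<And>p'. p' \<noteq> 0 \<Longrightarrow> (\<lambda>x y. poly p' (v x y)) \<in> K \<Longrightarrow> degree p \<le> degree p'"
    using q ex_has_least_nat[of "\<lambda>p. p \<noteq> 0 \<and> (\<lambda>x y. poly p (v x y)) \<in> K" q degree] by blast
  have "degree p \<noteq> 0"
  proof
    assume "degree p = 0"
    then obtain a where "p = [:a:]" by (rule degree_eq_zeroE)
    with p mult[OF p(2), of "\<lambda>x y. 1 / a"] proper show False by simp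
  qed
  then obtain c where "poly p c = 0"
    using fundamental_theorem_of_algebra[of p] constant_degree[of p] by auto
  then obtain p' where p': "p = [:- c, 1:] * p'" by (auto simp: poly_eq_0_iff_dvd elim: dvdE)
  with p(1) have "p' \<noteq> 0" by auto
  with p' have deg: "degree p = Suc (degree p')" by (simp add: degree_mult_eq del: mult_pCons_left)
  show ?thesis
  proof (rule exI[of _ c], intro ballI, rule ccontr)
    fix k r assume k: "k \<in> K" and r: "r \<in> poly_funs" and "\<not> (\<exists>x y. k x y + (v x y - c) * r x y \<noteq> 1)"
    then have one: "k x y + (v x y - c) * r x y = 1" for x y by auto
    have "(\<lambda>x y. k x y * poly p' (v x y) + poly p (v x y) * r x y) \<in> K"
      using k r p(2) v by (intro add mult) auto
    also have "(\<lambda>x y. k x y * poly p' (v x y) + poly p (v x y) * r x y) = (\<lambda>x y. poly p' (v x y))"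
    proof (intro ext)
      fix x y
      have "k x y * poly p' (v x y) + poly p (v x y) * r x y
          = (k x y + (v x y - c) * r x y) * poly p' (v x y)"
        unfolding p' poly_mult by (simp add: algebra_simps)
      then show "k x y * poly p' (v x y) + poly p (v x y) * r x y = poly p' (v x y)"
        using one by simp
    qed
    finally have "degree p \<le> degree p'" using min \<open>p' \<noteq> 0\<close> by blast
    with deg show False by simp
  qed
qed

text \<open>The weak Nullstellensatz in the plane, with integrality modulo \<open>K\<close> as a
  hypothesis. Fixing x = a and then y = b keeps the ideal proper, whereas an element not vanishing
  at (a, b) would generate 1 together with x - a and y - b.\<close>

lemma ideal_common_zero:
  fixes K :: "(complex \<Rightarrow> complex \<Rightarrow> complex) set"
  assumes sub: "K \<subseteq> poly_funs"
    and add: "\<And>f g. f \<in> K \<Longrightarrow> g \<in> K \<Longrightarrow> (\<lambda>x y. f x y + g x y) \<in> K"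
    and mult: "\<And>f g. f \<in> K \<Longrightarrow> g \<in> poly_funs \<Longrightarrow> (\<lambda>x y. f x y * g x y) \<in> K"
    and proper: "(\<lambda>x y. 1) \<notin> K"
    and integral: "\<And>v. v \<in> poly_funs \<Longrightarrow> \<exists>q. q \<noteq> 0 \<and> (\<lambda>x y. poly q (v x y)) \<in> K"
  shows "\<exists>a b. \<forall>k\<in>K. k a b = 0"
proof -
  obtain q where q: "q \<noteq> 0" "(\<lambda>x y. poly q x) \<in> K" using integral[of "\<lambda>x y. x"] by auto
  obtain a where a: "\<forall>k\<in>K. \<forall>r\<in>poly_funs. \<exists>x y. k x y + (x - a) * r x y \<noteq> 1"
    using ideal_adjoin_root[OF add mult proper poly_funs_fst q] ..
  \<comment> \<open>The ideal generated by \<open>K\<close> and x - a. It is proper by the choice of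
    \<open>a\<close>, so the same step applies to the second coordinate.\<close>
  define L where "L = {\<lambda>x y. k x y + (x - a) * r x y | k r. k \<in> K \<and> r \<in> poly_funs}"
  have LI: "f \<in> L" if "k \<in> K" "r \<in> poly_funs" "\<And>x y. f x y = k x y + (x - a) * r x y" for f k r
    using that unfolding L_def by (intro CollectI exI[of _ k] exI[of _ r]) auto
  have KL: "k \<in> L" if "k \<in> K" for k using LI[OF that, of "\<lambda>x y. 0" k] by simp
  obtain q' where q': "q' \<noteq> 0" "(\<lambda>x y. poly q' y) \<in> K" using integral[of "\<lambda>x y. y"] by auto
  have L_add: "(\<lambda>x y. f x y + g x y) \<in> L" if fg: "f \<in> L" "g \<in> L" for f g
  proof -
    obtain k r k' r' where "k \<in> K" "r \<in> poly_funs" "f = (\<lambda>x y. k x y + (x - a) * r x y)"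
      "k' \<in> K" "r' \<in> poly_funs" "g = (\<lambda>x y. k' x y + (x - a) * r' x y)"
      using fg unfolding L_def by blast
    then show ?thesis
      by (intro LI[of "\<lambda>x y. k x y + k' x y" "\<lambda>x y. r x y + r' x y"] add) (auto simp: algebra_simps)
  qed
  have L_mult: "(\<lambda>x y. f x y * g x y) \<in> L" if fg: "f \<in> L" "g \<in> poly_funs" for f g
  proof -
    obtain k r where "k \<in> K" "r \<in> poly_funs" "f = (\<lambda>x y. k x y + (x - a) * r x y)"
      using fg unfolding L_def by blast
    then show ?thesis using fg(2)
      by (intro LI[of "\<lambda>x y. k x y * g x y" "\<lambda>x y. r x y * g x y"] mult) (auto simp: algebra_simps)
  qed
  have L_proper: "(\<lambda>x y. 1) \<notin> L"
  proof
    assume "(\<lambda>x y. 1) \<in> L"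
    then obtain k r where kr: "k \<in> K" "r \<in> poly_funs" "(\<lambda>x y. 1) = (\<lambda>x y. k x y + (x - a) * r x y)"
      unfolding L_def by blast
    then show False using a by (metis (mono_tags, lifting))
  qed
  obtain b where b: "\<forall>k\<in>L. \<forall>r\<in>poly_funs. \<exists>x y. k x y + (y - b) * r x y \<noteq> 1"
    using ideal_adjoin_root[OF L_add L_mult L_proper poly_funs_snd q'(1) KL[OF q'(2)]] ..
  have "k a b = 0" if k: "k \<in> K" for k
  proof (rule ccontr)
    assume nz: "k a b \<noteq> 0"
    obtain g h where gh: "g \<in> poly_funs" "h \<in> poly_funs"
      "\<And>x y. k x y = k a b + (x - a) * g x y + (y - b) * h x y"
      using poly_funs_taylor[of k a b] k sub by blast
    \<comment> \<open>Hadamard's expansion of \<open>k\<close>, divided by \<open>k a b\<close>,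
      writes 1 as this element of \<open>L\<close> plus a multiple of y - b.\<close>
    let ?l = "\<lambda>x y. k x y * (1 / k a b) + (x - a) * (- g x y * (1 / k a b))"
    have l: "?l \<in> L" 
      by (rule LI[OF mult[OF k, of "\<lambda>x y. 1 / k a b"], of "\<lambda>x y. - g x y * (1 / k a b)"])
        (use gh(1) in simp_all)
    have h': "(\<lambda>x y. - h x y * (1 / k a b)) \<in> poly_funs" using gh(2) by simp
    obtain x y where "?l x y + (y - b) * (- h x y * (1 / k a b)) \<noteq> 1"
      using b[rule_format, OF l h'] by blast
    moreover have "?l x y + (y - b) * (- h x y * (1 / k a b))
        = (k x y - (x - a) * g x y - (y - b) * h x y) / k a b"
      by (simp add: diff_divide_distrib)
    ultimately show False using gh(3)[of x y] nz by simp
  qed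
  then show ?thesis by blast
qed

section \<open>Common zeros of two cubics\<close>

text \<open>Reducing one Bezout coefficient modulo \<open>p\<close> brings its degree down to 2, so
  v q has degree at most 5 and stays within the bound once 5 \<le> n. In homogeneous terms, two
  coprime cubic forms generate all forms of degree at least 5.\<close>

lemma coprime_combination_bounded:
  fixes p q f :: "complex poly"
  assumes "coprime p q" "degree p = 3" "degree q \<le> 3" "degree f \<le> n" "5 \<le> n"
  obtains u v where "f = u * p + v * q" "degree u \<le> n - 3" "degree v \<le> n - 3"
proof -
  obtain u0 v0 where bez: "u0 * p + v0 * q = 1"
    using bezout_coefficients_fst_snd[of p q] assms(1) by auto
  define v where "v = (f * v0) mod p"
  have v: "degree v \<le> 2"
  proof (cases "v = 0")
    case False
    moreover have "p \<noteq> 0" using assms(2) by auto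
    ultimately show ?thesis using degree_mod_less[of p "f * v0"] assms(2) by (auto simp: v_def)
  qed simp
  have "f - v * q = f * (u0 * p + v0 * q) - v * q" using bez by simp
  also have "\<dots> = p * (f * u0 + (f * v0 div p) * q)"
    by (simp add: v_def algebra_simps flip: minus_div_mult_eq_mod)
  finally obtain u where u: "f - v * q = p * u" by blast
  have "degree (v * q) \<le> n"
    using degree_mult_le[of v q] v assms(3,5) by linarith
  then have "degree (p * u) \<le> n"
    using assms(4) by (simp flip: u add: degree_diff_le)
  then have "degree u \<le> n - 3"
    using assms(2) degree_mult_eq[of p u] by (cases "u = 0"; cases "p = 0") auto
  then show ?thesis using that[of u v] u v assms(5) by (auto simp: algebra_simps)
qed

section \<open>The ideal of two cubics that do not meet at infinity\<close>

text \<open>The leading forms have no common zero on the projective line: \<open>coprime\<close>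
  excludes zeros with y \<noteq> 0, and \<open>degree_eq\<close> the one with y = 0.\<close>

locale coprime_cubics =
  fixes P Q P' Q' :: "complex \<Rightarrow> complex \<Rightarrow> complex" and p q :: "complex poly"
  assumes P: "P x y = form 3 p x y + P' x y" and Q: "Q x y = form 3 q x y + Q' x y"
    and lower: "P' \<in> poly_fun 2" "Q' \<in> poly_fun 2"
    and degree_le: "degree p \<le> 3" "degree q \<le> 3"
    and degree_eq: "degree p = 3 \<or> degree q = 3"
    and coprime: "coprime p q"
begin

definition ideal :: "(complex \<Rightarrow> complex \<Rightarrow> complex) set" where
  "ideal = {f. \<exists>a\<in>poly_funs. \<exists>b\<in>poly_funs. \<forall>x y. f x y = a x y * P x y + b x y * Q x y}"

lemma PQ_poly_fun: "P \<in> poly_fun 3" "Q \<in> poly_fun 3"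
proof -
  have "(\<lambda>x y. form 3 p x y + P' x y) \<in> poly_fun 3" "(\<lambda>x y. form 3 q x y + Q' x y) \<in> poly_fun 3"
    using lower degree_le by (auto intro!: poly_fun_add form_in_poly_fun elim: poly_fun_mono)
  then show "P \<in> poly_fun 3" "Q \<in> poly_fun 3" by (simp_all flip: P Q)
qed

lemma idealI:
  "a \<in> poly_funs \<Longrightarrow> b \<in> poly_funs \<Longrightarrow> (\<And>x y. f x y = a x y * P x y + b x y * Q x y) \<Longrightarrow> f \<in> ideal"
  unfolding ideal_def by blast

lemma idealE:
  assumes "f \<in> ideal"
  obtains a b where "a \<in> poly_funs" "b \<in> poly_funs" "\<And>x y. f x y = a x y * P x y + b x y * Q x y"
  using assms unfolding ideal_def by blast

lemma ideal_sub: "f \<in> ideal \<Longrightarrow> f \<in> poly_funs"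
proof (erule idealE)
  fix a b assume "a \<in> poly_funs" "b \<in> poly_funs" and f: "\<And>x y. f x y = a x y * P x y + b x y * Q x y"
  then have "(\<lambda>x y. a x y * P x y + b x y * Q x y) \<in> poly_funs"
    using PQ_poly_fun[THEN poly_funsI] by simp
  then show "f \<in> poly_funs" by (simp flip: f)
qed

lemma ideal_add: "f \<in> ideal \<Longrightarrow> g \<in> ideal \<Longrightarrow> (\<lambda>x y. f x y + g x y) \<in> ideal"
proof (elim idealE)
  fix a b a' b'
  assume "a \<in> poly_funs" "b \<in> poly_funs" "\<And>x y. f x y = a x y * P x y + b x y * Q x y"
    "a' \<in> poly_funs" "b' \<in> poly_funs" "\<And>x y. g x y = a' x y * P x y + b' x y * Q x y"
  then show ?thesis
    by (intro idealI[of "\<lambda>x y. a x y + a' x y" "\<lambda>x y. b x y + b' x y"]) (auto simp: algebra_simps)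
qed

lemma ideal_mult: "f \<in> ideal \<Longrightarrow> g \<in> poly_funs \<Longrightarrow> (\<lambda>x y. f x y * g x y) \<in> ideal"
proof (erule idealE)
  fix a b
  assume "g \<in> poly_funs" "a \<in> poly_funs" "b \<in> poly_funs" "\<And>x y. f x y = a x y * P x y + b x y * Q x y"
  then show ?thesis
    by (intro idealI[of "\<lambda>x y. a x y * g x y" "\<lambda>x y. b x y * g x y"]) (auto simp: algebra_simps)
qed

lemma nonzero: "p \<noteq> 0" "q \<noteq> 0"
  using coprime degree_eq
  by (metis is_unit_iff_degree degree_0 coprime_0_left_iff coprime_0_right_iff zero_neq_numeral)+

text \<open>Coprimality makes the Koszul relation the only one. The disjunction keeps the bound on
  \<open>degree r\<close> meaningful for n < 3, where only r = 0 is possible.\<close>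

lemma syzygy:
  assumes eq: "\<alpha> * p + \<beta> * q = 0" and deg: "degree \<alpha> \<le> n" "degree \<beta> \<le> n"
  obtains r where "\<alpha> = r * q" "\<beta> = - r * p" "r = 0 \<or> 3 \<le> n \<and> degree r \<le> n - 3"
proof -
  have "p dvd \<beta> * q"
    using eq by (metis add_eq_0_iff dvd_minus_iff dvd_triv_right)
  then have "p dvd \<beta>" using coprime by (simp add: coprime_dvd_mult_left_iff)
  then obtain s where s: "\<beta> = p * s" by (rule dvdE)
  with eq have "p * (\<alpha> + s * q) = 0" by (simp add: algebra_simps)
  then have \<alpha>: "\<alpha> = - s * q" using nonzero by (simp add: add_eq_0_iff)
  have "- s = 0 \<or> 3 \<le> n \<and> degree (- s) \<le> n - 3"
  proof (cases "s = 0")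
    case False
    then have "degree \<alpha> = degree s + degree q" "degree \<beta> = degree p + degree s"
      using nonzero unfolding \<alpha> s by (auto simp: degree_mult_eq)
    then show ?thesis using deg degree_eq by auto
  qed simp
  then show ?thesis using that[of "- s"] \<alpha> s by (simp add: mult.commute)
qed

text \<open>Hence the part of \<open>ideal\<close> of degree at most 4 is spanned by the products of
  P, Q with 1, x, y. As long as the coefficients have degree above 1, their leading parts must
  cancel, so they form a Koszul relation, and subtracting a multiple of (Q, -P) lowers the
  degree.\<close>

lemma reduce_coefficients:
  assumes "h \<in> poly_fun 4" "a \<in> poly_fun n" "b \<in> poly_fun n" "1 \<le> n"
    and "\<And>x y. h x y = a x y * P x y + b x y * Q x y"
  obtains a' b' where "a' \<in> poly_fun 1" "b' \<in> poly_fun 1"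
    "\<And>x y. h x y = a' x y * P x y + b' x y * Q x y"
  using assms(2-)
proof (induction n arbitrary: a b thesis)
  case (Suc n)
  show ?case
  proof (cases "n = 0")
    case True
    then show ?thesis using Suc.prems by (intro Suc.prems(1)[of a b]) auto
  next
    case n: False
    obtain \<alpha> a1 where a: "degree \<alpha> \<le> Suc n" "a1 \<in> poly_fun n" "\<And>x y. a x y = form (Suc n) \<alpha> x y + a1 x y"
      using Suc.prems(2) by (rule poly_fun_Suc_cases) blast
    obtain \<beta> b1 where b: "degree \<beta> \<le> Suc n" "b1 \<in> poly_fun n" "\<And>x y. b x y = form (Suc n) \<beta> x y + b1 x y"
      using Suc.prems(3) by (rule poly_fun_Suc_cases) blast
    let ?\<gamma> = "\<alpha> * p + \<beta> * q"
    \<comment> \<open>The left side is the leading contribution, of degree n + 4. Every term on the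
      right has degree at most n + 3, including \<open>h\<close> because n \<ge> 1.\<close>
    have top: "form (Suc (n + 3)) ?\<gamma> x y = h x y - a1 x y * P x y - b1 x y * Q x y
        - form (Suc n) \<alpha> x y * P' x y - form (Suc n) \<beta> x y * Q' x y" for x y
      using form_mult[of \<alpha> "Suc n" p 3 x y] form_mult[of \<beta> "Suc n" q 3 x y] a b degree_le Suc.prems(5)[of x y]
      by (simp add: form_add P Q algebra_simps)
    have "(\<lambda>x y. h x y - a1 x y * P x y - b1 x y * Q x y
        - form (Suc n) \<alpha> x y * P' x y - form (Suc n) \<beta> x y * Q' x y) \<in> poly_fun (n + 3)"
    proof (intro poly_fun_diff)
      show "h \<in> poly_fun (n + 3)" using assms(1) by (rule poly_fun_mono) (use n in simp)
      show "(\<lambda>x y. a1 x y * P x y) \<in> poly_fun (n + 3)" "(\<lambda>x y. b1 x y * Q x y) \<in> poly_fun (n + 3)"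
        using a b PQ_poly_fun by (auto intro: poly_fun_mult)
      have "(\<lambda>x y. form (Suc n) \<alpha> x y * P' x y) \<in> poly_fun (Suc n + 2)"
        "(\<lambda>x y. form (Suc n) \<beta> x y * Q' x y) \<in> poly_fun (Suc n + 2)"
        using a(1) b(1) lower by (intro poly_fun_mult form_in_poly_fun; simp)+
      then show "(\<lambda>x y. form (Suc n) \<alpha> x y * P' x y) \<in> poly_fun (n + 3)"
        "(\<lambda>x y. form (Suc n) \<beta> x y * Q' x y) \<in> poly_fun (n + 3)"
        by (simp_all add: eval_nat_numeral)
    qed
    then have "form (Suc (n + 3)) ?\<gamma> \<in> poly_fun (n + 3)" by (simp flip: top)
    moreover have "degree (\<alpha> * p) \<le> Suc (n + 3)" "degree (\<beta> * q) \<le> Suc (n + 3)"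
      using degree_mult_le[of \<alpha> p] degree_mult_le[of \<beta> q] a(1) b(1) degree_le by linarith+
    ultimately have "?\<gamma> = 0" by (intro form_Suc_in_poly_fun[OF _ degree_add_le])
    then obtain r where r: "\<alpha> = r * q" "\<beta> = - r * p" "r = 0 \<or> 3 \<le> Suc n \<and> degree r \<le> Suc n - 3"
      using a(1) b(1) by (rule syzygy)
    define R where "R = form (Suc n - 3) r"
    have \<alpha>: "form (Suc n) \<alpha> x y = R x y * form 3 q x y" for x y
      using r(1,3) form_mult[of r "Suc n - 3" q 3 x y] degree_le by (auto simp: R_def)
    have "form (Suc n) (r * p) x y = R x y * form 3 p x y" for x y
      using r(3) form_mult[of r "Suc n - 3" p 3 x y] degree_le by (auto simp: R_def)
    then have \<beta>: "form (Suc n) \<beta> x y = - (R x y * form 3 p x y)" for x y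
      unfolding r(2) by (simp add: form_minus)
    have R: "(\<lambda>x y. R x y * f x y) \<in> poly_fun n" if "f \<in> poly_fun 2" for f
    proof (cases "r = 0")
      case False
      then have R3: "R \<in> poly_fun (Suc n - 3)" using r(3) unfolding R_def by (intro form_in_poly_fun) auto
      have "Suc n - 3 + 2 = n" using False r(3) by linarith
      with poly_fun_mult[OF R3 that] show ?thesis by simp
    qed (simp add: R_def)
    \<comment> \<open>The new coefficients are a - R Q and b + R P, written with their leading parts
      cancelled.\<close>
    show ?thesis
    proof (rule Suc.IH)
      show "(\<lambda>x y. a1 x y - R x y * Q' x y) \<in> poly_fun n" using R[OF lower(2)] a(2) by (rule poly_fun_diff[rotated])
      show "(\<lambda>x y. b1 x y + R x y * P' x y) \<in> poly_fun n" using R[OF lower(1)] b(2) by (rule poly_fun_add[rotated])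
      show "h x y = (a1 x y - R x y * Q' x y) * P x y + (b1 x y + R x y * P' x y) * Q x y" for x y
        unfolding Suc.prems(5) a(3) b(3) \<alpha> \<beta> P Q by (simp add: algebra_simps)
    qed (use n Suc.prems(1) in auto)
  qed
qed simp

text \<open>From degree 5 on the leading form is a combination of the two leading cubics, so it can
  be removed modulo \<open>ideal\<close>; the descent stops at degree 4.\<close>

lemma reduce_mod_ideal:
  assumes "f \<in> poly_fun n"
  obtains g r where "g \<in> ideal" "r \<in> poly_fun 4" "\<And>x y. f x y = g x y + r x y"
  using assms
proof (induction n arbitrary: f thesis)
  case 0
  have "(\<lambda>x y. 0) \<in> ideal" by (rule idealI[of "\<lambda>x y. 0" "\<lambda>x y. 0"]) auto
  moreover have "f \<in> poly_fun 4" using 0(2) by (rule poly_fun_mono) simp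
  ultimately show ?case by (rule 0(1)) simp
next
  case (Suc n)
  show ?case
  proof (cases "Suc n \<le> 4")
    case True
    have "(\<lambda>x y. 0) \<in> ideal" by (rule idealI[of "\<lambda>x y. 0" "\<lambda>x y. 0"]) auto
    moreover have "f \<in> poly_fun 4" using Suc.prems(2) True by (rule poly_fun_mono)
    ultimately show ?thesis by (rule Suc.prems(1)) simp
  next
    case False
    obtain \<phi> f1 where f: "degree \<phi> \<le> Suc n" "f1 \<in> poly_fun n" "\<And>x y. f x y = form (Suc n) \<phi> x y + f1 x y"
      using Suc.prems(2) by (rule poly_fun_Suc_cases) blast
    \<comment> \<open>The combination lemma wants its first cubic of exact degree 3, which may be
      either of the two.\<close>
    obtain u v where uv: "\<phi> = u * p + v * q" "degree u \<le> Suc n - 3" "degree v \<le> Suc n - 3"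
    proof (cases "degree p = 3")
      case True
      show ?thesis
      proof (rule coprime_combination_bounded[OF coprime True degree_le(2) f(1)])
        show "5 \<le> Suc n" using False by simp
      qed (rule that)
    next
      case p: False
      with degree_eq have "degree q = 3" by simp
      moreover have "degree p \<le> 3" using degree_le by simp
      moreover have "coprime q p" using coprime by (simp add: coprime_commute)
      moreover have "5 \<le> Suc n" using False by simp
      ultimately obtain u v where "\<phi> = u * q + v * p" "degree u \<le> Suc n - 3" "degree v \<le> Suc n - 3"
        using coprime_combination_bounded[OF _ _ _ f(1)] by metis
      then show ?thesis by (intro that[of v u]) simp_all
    qed
    define U V where "U = form (Suc n - 3) u" and "V = form (Suc n - 3) v"
    have UV: "U \<in> poly_fun (Suc n - 3)" "V \<in> poly_fun (Suc n - 3)"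
      using uv unfolding U_def V_def by (auto intro: form_in_poly_fun)
    have \<phi>: "form (Suc n) \<phi> x y = U x y * form 3 p x y + V x y * form 3 q x y" for x y
      using form_mult[of u "Suc n - 3" p 3 x y] form_mult[of v "Suc n - 3" q 3 x y] uv degree_le False
      by (simp add: form_add U_def V_def)
    have n: "Suc n - 3 + 2 = n" using False by simp
    have "(\<lambda>x y. U x y * P' x y) \<in> poly_fun n" "(\<lambda>x y. V x y * Q' x y) \<in> poly_fun n"
      using poly_fun_mult[OF UV(1) lower(1)] poly_fun_mult[OF UV(2) lower(2)] unfolding n by simp_all
    then have lower_part: "(\<lambda>x y. f1 x y - U x y * P' x y - V x y * Q' x y) \<in> poly_fun n"
      using f(2) by (intro poly_fun_diff)
    obtain g r where gr: "g \<in> ideal" "r \<in> poly_fun 4"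
      "\<And>x y. f1 x y - U x y * P' x y - V x y * Q' x y = g x y + r x y"
      by (rule Suc.IH[OF _ lower_part]) (rule that)
    have "(\<lambda>x y. U x y * P x y + V x y * Q x y) \<in> ideal"
      using UV by (intro idealI[of U V]) (auto intro: poly_funsI)
    then have "(\<lambda>x y. U x y * P x y + V x y * Q x y + g x y) \<in> ideal" using gr(1) by (rule ideal_add)
    moreover have "f x y = U x y * P x y + V x y * Q x y + g x y + r x y" for x y
      using gr(3)[of x y] unfolding f(3) \<phi> P Q by (simp add: algebra_simps)
    ultimately show ?thesis using gr(2) Suc.prems(1) by blast
  qed
qed

text \<open>Modulo \<open>ideal\<close> the 16 powers of \<open>v\<close> with exponents 0 to 15 lie
  in the span of the 15 monomials of degree at most 4, so they are linearly dependent.\<close>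

lemma integral_mod_ideal:
  assumes v: "v \<in> poly_funs"
  shows "\<exists>s. s \<noteq> 0 \<and> (\<lambda>x y. poly s (v x y)) \<in> ideal"
proof -
  have "\<exists>g c. g \<in> ideal \<and> (\<forall>x y. v x y ^ k = g x y + (\<Sum>e\<in>mons 4. c e * mon e x y))" for k
  proof -
    obtain n where "(\<lambda>x y. v x y ^ k) \<in> poly_fun n" using poly_funs_power[OF v, of k] by (auto simp: poly_funs_def)
    then obtain g r where gr: "g \<in> ideal" "r \<in> poly_fun 4" "\<And>x y. v x y ^ k = g x y + r x y"
      by (rule reduce_mod_ideal) blast
    obtain c where "\<And>x y. r x y = (\<Sum>e\<in>mons 4. c e * mon e x y)"
      using poly_fun_mons[OF gr(2)] by auto
    then show ?thesis using gr by (intro exI[of _ g] exI[of _ c]) simp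
  qed
  then obtain g c where gc: "\<And>k. g k \<in> ideal" "\<And>k x y. v x y ^ k = g k x y + (\<Sum>e\<in>mons 4. c k e * mon e x y)"
    by metis
  obtain u where u: "\<exists>k\<in>{..15}. u k \<noteq> 0" "\<And>e. e \<in> mons 4 \<Longrightarrow> (\<Sum>k\<le>15. c k e * u k) = 0"
    using homogeneous_system_nontrivial[of "mons 4" "{..15::nat}" "\<lambda>e k. c k e"] by (auto simp: card_mons_4)
  define s where "s = (\<Sum>k\<le>15. monom (u k) k)"
  have "coeff s k = u k" if "k \<le> 15" for k using that by (simp add: s_def coeff_sum)
  then have "s \<noteq> 0" using u(1) by auto
  moreover have "poly s (v x y) = (\<Sum>k\<le>15. g k x y * u k)" for x y
  proof -
    have "poly s (v x y) = (\<Sum>k\<le>15. u k * (g k x y + (\<Sum>e\<in>mons 4. c k e * mon e x y)))"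
      by (simp add: s_def poly_sum poly_monom gc(2))
    also have "\<dots> = (\<Sum>k\<le>15. g k x y * u k) + (\<Sum>k\<le>15. \<Sum>e\<in>mons 4. c k e * u k * mon e x y)"
      by (simp add: distrib_left sum.distrib sum_distrib_left mult_ac)
    also have "(\<Sum>k\<le>15. \<Sum>e\<in>mons 4. c k e * u k * mon e x y) = (\<Sum>e\<in>mons 4. (\<Sum>k\<le>15. c k e * u k) * mon e x y)"
      by (subst sum.swap) (simp add: sum_distrib_right)
    finally show ?thesis by (simp add: u(2))
  qed
  moreover have "(\<lambda>x y. \<Sum>k\<in>A. g k x y * u k) \<in> ideal" if "finite A" for A
    using that
  proof induction
    case empty
    show ?case by (rule idealI[of "\<lambda>x y. 0" "\<lambda>x y. 0"]) auto
  next
    case (insert k A)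
    then show ?case using ideal_add[OF ideal_mult[OF gc(1)[of k], of "\<lambda>x y. u k"] insert.IH] by simp
  qed
  ultimately show ?thesis by (intro exI[of _ s]) simp
qed

end

text \<open>At a simple common zero \<open>(a, b)\<close> Cramer's rule shows that the Jacobian cofactor
  multiplies the maximal ideal of \<open>(a, b)\<close> into \<open>ideal\<close>.\<close>

locale simple_coprime_cubics = coprime_cubics +
  assumes simple: "P a b = 0 \<Longrightarrow> Q a b = 0 \<Longrightarrow>
    \<exists>\<alpha>\<in>poly_funs. \<exists>\<beta>\<in>poly_funs. \<exists>\<gamma>\<in>poly_funs. \<exists>\<delta>\<in>poly_funs.
      (\<forall>x y. P x y = (x - a) * \<alpha> x y + (y - b) * \<beta> x y) \<and>
      (\<forall>x y. Q x y = (x - a) * \<gamma> x y + (y - b) * \<delta> x y) \<and>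
      \<alpha> a b * \<delta> a b - \<beta> a b * \<gamma> a b \<noteq> 0"
begin

text \<open>Simplicity of the zeros makes \<open>ideal\<close> radical. Were \<open>h\<close>
  outside, the quotient ideal \<open>K\<close> would be proper and have a zero (a, b), which is then
  a common zero of P and Q; but the Jacobian cofactor lies in \<open>K\<close> and does not vanish
  there.\<close>

lemma vanishing_in_ideal:
  assumes h: "h \<in> poly_funs" and vanish: "\<And>a b. P a b = 0 \<Longrightarrow> Q a b = 0 \<Longrightarrow> h a b = 0"
  shows "h \<in> ideal"
proof (rule ccontr)
  assume notin: "h \<notin> ideal"
  define K where "K = {g \<in> poly_funs. (\<lambda>x y. g x y * h x y) \<in> ideal}"
  have ideal_K: "f \<in> K" if "f \<in> ideal" for f
    using that ideal_mult[OF that h] ideal_sub by (auto simp: K_def)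
  have K_add: "(\<lambda>x y. f x y + g x y) \<in> K" if "f \<in> K" "g \<in> K" for f g
    using that ideal_add[of "\<lambda>x y. f x y * h x y" "\<lambda>x y. g x y * h x y"]
    by (auto simp: K_def distrib_right)
  have K_mult: "(\<lambda>x y. f x y * g x y) \<in> K" if "f \<in> K" "g \<in> poly_funs" for f g
    using that ideal_mult[of "\<lambda>x y. f x y * h x y" g] by (auto simp: K_def mult_ac)
  have K_sub: "K \<subseteq> poly_funs" and K_proper: "(\<lambda>x y. 1) \<notin> K" using notin by (auto simp: K_def)
  have K_integral: "\<exists>s. s \<noteq> 0 \<and> (\<lambda>x y. poly s (v x y)) \<in> K" if "v \<in> poly_funs" for v
    using integral_mod_ideal[OF that] ideal_K by blast
  have "\<exists>a b. \<forall>k\<in>K. k a b = 0"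
    by (rule ideal_common_zero[OF K_sub K_add K_mult K_proper K_integral])
  then obtain a b where ab: "\<forall>k\<in>K. k a b = 0" by (elim exE)
  have "P \<in> ideal" "Q \<in> ideal"
    by (rule idealI[of "\<lambda>x y. 1" "\<lambda>x y. 0"]; simp) (rule idealI[of "\<lambda>x y. 0" "\<lambda>x y. 1"]; simp)
  then have zero: "P a b = 0" "Q a b = 0" using ab ideal_K by blast+
  from simple[OF this] obtain \<alpha> \<beta> \<gamma> \<delta> where
    in_poly: "\<alpha> \<in> poly_funs" "\<beta> \<in> poly_funs" "\<gamma> \<in> poly_funs" "\<delta> \<in> poly_funs" and
    dec: "\<And>x y. P x y = (x - a) * \<alpha> x y + (y - b) * \<beta> x y" "\<And>x y. Q x y = (x - a) * \<gamma> x y + (y - b) * \<delta> x y" and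
    jac: "\<alpha> a b * \<delta> a b - \<beta> a b * \<gamma> a b \<noteq> 0" by blast
  obtain h1 h2 where h12: "h1 \<in> poly_funs" "h2 \<in> poly_funs"
    "\<And>x y. h x y = h a b + (x - a) * h1 x y + (y - b) * h2 x y"
    using poly_funs_taylor[OF h, of a b] by blast
  have hx: "h x y = (x - a) * h1 x y + (y - b) * h2 x y" for x y
    using h12(3)[of x y] vanish[OF zero] by simp
  \<comment> \<open>With J = \<alpha> \<delta> - \<beta> \<gamma> one has (x - a) J = \<delta> P -
    \<beta> Q and (y - b) J = \<alpha> Q - \<gamma> P.\<close>
  have "(\<lambda>x y. (\<alpha> x y * \<delta> x y - \<beta> x y * \<gamma> x y) * h x y) \<in> ideal"
    by (rule idealI[of "\<lambda>x y. \<delta> x y * h1 x y - \<gamma> x y * h2 x y" "\<lambda>x y. \<alpha> x y * h2 x y - \<beta> x y * h1 x y"])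
      (use in_poly h12(1,2) in \<open>simp_all add: hx dec algebra_simps\<close>)
  then have "(\<lambda>x y. \<alpha> x y * \<delta> x y - \<beta> x y * \<gamma> x y) \<in> K"
    using in_poly by (simp add: K_def)
  from bspec[OF ab this] jac show False by simp
qed

text \<open>With at most 8 zeros, vanishing on them and Hermitian orthogonality to the six products
  of P, Q with 1, x, y impose at most 14 conditions on the 15 coefficients of a quartic. A nonzero
  solution \<open>h\<close> lies in \<open>ideal\<close>, hence in the span of the six products, and
  is orthogonal to itself.\<close>

lemma card_common_zeros_ge:
  assumes "finite {(a, b). P a b = 0 \<and> Q a b = 0}"
  shows "9 \<le> card {(a, b). P a b = 0 \<and> Q a b = 0}" (is "_ \<le> card ?Z")
proof (rule ccontr)
  assume "\<not> 9 \<le> card ?Z"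
  define g where "g s = [P, \<lambda>x y. x * P x y, \<lambda>x y. y * P x y, Q, \<lambda>x y. x * Q x y, \<lambda>x y. y * Q x y] ! s" for s
  have g_simps: "g 0 = P" "g 1 = (\<lambda>x y. x * P x y)" "g 2 = (\<lambda>x y. y * P x y)"
    "g 3 = Q" "g 4 = (\<lambda>x y. x * Q x y)" "g 5 = (\<lambda>x y. y * Q x y)"
    by (simp_all add: g_def)
  have xP: "(\<lambda>x y. x * f x y) \<in> poly_fun 4" "(\<lambda>x y. y * f x y) \<in> poly_fun 4" "f \<in> poly_fun 4"
    if "f \<in> poly_fun 3" for f :: "complex \<Rightarrow> complex \<Rightarrow> complex"
    using poly_fun_mult[OF poly_fun_fst[of 1] that] poly_fun_mult[OF poly_fun_snd[of 1] that]
      poly_fun_mono[OF that] by simp_all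
  have g4: "g s \<in> poly_fun 4" if "s < 6" for s
  proof -
    have "s \<in> {0, 1, 2, 3, 4, 5}" using that by auto
    then show ?thesis using xP[OF PQ_poly_fun(1)] xP[OF PQ_poly_fun(2)] by (auto simp: g_simps g_simps(2)[simplified])
  qed
  have "\<exists>c. \<forall>x y. g s x y = (\<Sum>e\<in>mons 4. c e * mon e x y)" if "s < 6" for s
    by (rule poly_fun_mons[OF g4[OF that]])
  then obtain G where G: "\<And>s x y. s < 6 \<Longrightarrow> g s x y = (\<Sum>e\<in>mons 4. G s e * mon e x y)" by metis
  \<comment> \<open>\<open>Inl\<close> indexes the vanishing conditions and \<open>Inr\<close> the
    orthogonality conditions, Hermitian by the conjugation of \<open>G\<close>.\<close>
  define A where "A = (\<lambda>eq e. case eq of Inl (a, b) \<Rightarrow> mon e a b | Inr s \<Rightarrow> cnj (G s e))"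
  have "finite (?Z <+> {..<6::nat})" "card (?Z <+> {..<6::nat}) < card (mons 4)"
    using assms \<open>\<not> 9 \<le> card ?Z\<close> by (simp_all add: card_Plus card_mons_4)
  from homogeneous_system_nontrivial[OF this(1) finite_mons this(2), of A] obtain u where
    u: "\<exists>e\<in>mons 4. u e \<noteq> 0" "\<And>i. i \<in> ?Z <+> {..<6::nat} \<Longrightarrow> (\<Sum>e\<in>mons 4. A i e * u e) = 0" by blast
  define h where "h x y = (\<Sum>e\<in>mons 4. u e * mon e x y)" for x y
  have h4: "h \<in> poly_fun 4" unfolding h_def[abs_def] by (rule sum_mons_in_poly_fun)
  have "h a b = 0" if "P a b = 0" "Q a b = 0" for a b
    using u(2)[of "Inl (a, b)"] that by (auto simp: A_def h_def mult.commute)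
  then have "h \<in> ideal" using vanishing_in_ideal h4[THEN poly_funsI] by blast
  then obtain a b where ab: "a \<in> poly_funs" "b \<in> poly_funs" "\<And>x y. h x y = a x y * P x y + b x y * Q x y"
    by (rule idealE) blast
  obtain n where n: "a \<in> poly_fun n" "b \<in> poly_fun n" using ab(1,2) by (rule poly_funs_common_degree)
  have "a \<in> poly_fun (Suc n)" "b \<in> poly_fun (Suc n)" using n by (auto elim: poly_fun_mono)
  then obtain a' b' where ab': "a' \<in> poly_fun 1" "b' \<in> poly_fun 1" "\<And>x y. h x y = a' x y * P x y + b' x y * Q x y"
    using reduce_coefficients[OF h4, of a "Suc n" b] ab(3) by auto
  have linear: "\<exists>c0 c1 c2. \<forall>x y. f x y = c0 + c1 * x + c2 * y" if "f \<in> poly_fun 1" for f :: "complex \<Rightarrow> complex \<Rightarrow> complex"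
  proof -
    have "f \<in> poly_fun (Suc 0)" using that by simp
    then obtain \<phi> f1 where f: "f1 \<in> poly_fun 0" "\<And>x y. f x y = form (Suc 0) \<phi> x y + f1 x y"
      by (rule poly_fun_Suc_cases) blast
    then obtain c where "\<And>x y. f1 x y = c" by (auto simp: poly_fun_def form_def)
    then show ?thesis using f(2) by (intro exI[of _ c] exI[of _ "coeff \<phi> 1"] exI[of _ "coeff \<phi> 0"]) (simp add: form_1)
  qed
  obtain c0 c1 c2 d0 d1 d2 where
    "\<And>x y. a' x y = c0 + c1 * x + c2 * y" "\<And>x y. b' x y = d0 + d1 * x + d2 * y"
    using linear[OF ab'(1)] linear[OF ab'(2)] by blast
  then obtain c where "\<And>x y. h x y = (\<Sum>s<6. c s * g s x y)"
    using that[of "\<lambda>s. [c0, c1, c2, d0, d1, d2] ! s"] by (simp add: ab'(3) g_def eval_nat_numeral algebra_simps)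
  then have "(\<Sum>e\<in>mons 4. (u e - (\<Sum>s<6. c s * G s e)) * mon e x y) = 0" for x y
  proof -
    have "(\<Sum>e\<in>mons 4. (\<Sum>s<6. c s * G s e) * mon e x y) = (\<Sum>s<6. c s * (\<Sum>e\<in>mons 4. G s e * mon e x y))"
      by (simp add: sum_distrib_left sum_distrib_right mult.assoc) (rule sum.swap)
    also have "\<dots> = (\<Sum>s<6. c s * g s x y)" using G by simp
    finally show ?thesis using \<open>\<And>x y. h x y = (\<Sum>s<6. c s * g s x y)\<close>[of x y]
      by (simp add: h_def left_diff_distrib sum_subtractf)
  qed
  from mons_independent[OF this] have ue: "u e = (\<Sum>s<6. c s * G s e)" if "e \<in> mons 4" for e
    using that by simp
  have "(\<Sum>e\<in>mons 4. u e * cnj (u e)) = (\<Sum>e\<in>mons 4. \<Sum>s<6. cnj (c s) * (cnj (G s e) * u e))"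
    by (rule sum.cong) (simp_all add: ue sum_distrib_left mult_ac)
  also have "\<dots> = (\<Sum>s<6. cnj (c s) * (\<Sum>e\<in>mons 4. cnj (G s e) * u e))"
    by (subst sum.swap) (simp add: sum_distrib_left)
  also have "\<dots> = 0"
  proof (intro sum.neutral ballI)
    fix s :: nat assume "s \<in> {..<6}"
    then show "cnj (c s) * (\<Sum>e\<in>mons 4. cnj (G s e) * u e) = 0"
      using u(2)[of "Inr s"] by (simp add: A_def InrI)
  qed
  finally have "complex_of_real (\<Sum>e\<in>mons 4. (cmod (u e))\<^sup>2) = 0"
    unfolding of_real_sum complex_norm_square .
  then have "(\<Sum>e\<in>mons 4. (cmod (u e))\<^sup>2) = 0" by (simp only: of_real_eq_0_iff)
  then show False using u(1) by (simp add: sum_nonneg_eq_0_iff)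
qed

end

section \<open>The Bezoutian of the gradient\<close>

lemma peval_expand:
  "peval c x y = of_real (c 0 0) + of_real (c 1 0) * x + of_real (c 0 1) * y
    + of_real (c 2 0) * x^2 + of_real (c 1 1) * x * y + of_real (c 0 2) * y^2
    + of_real (c 3 0) * x^3 + of_real (c 2 1) * x^2 * y + of_real (c 1 2) * x * y^2 + of_real (c 0 3) * y^3
    + of_real (c 4 0) * x^4 + of_real (c 3 1) * x^3 * y + of_real (c 2 2) * x^2 * y^2
    + of_real (c 1 3) * x * y^3 + of_real (c 0 4) * y^4"
  for x y :: "'a::{real_algebra_1, comm_ring_1}"
proof -
  have s: "{..4} = {0, 1, 2, 3, 4::nat}" "{..3} = {0, 1, 2, 3::nat}" "{..2} = {0, 1, 2::nat}" "{..1} = {0, 1::nat}"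
    by auto
  show ?thesis by (simp add: peval_def s s(4)[simplified] add_ac)
qed

lemma top4_expand:
  "top4 c x y = of_real (c 4 0) * x^4 + of_real (c 3 1) * x^3 * y + of_real (c 2 2) * x^2 * y^2
    + of_real (c 1 3) * x * y^3 + of_real (c 0 4) * y^4"
  for x y :: "'a::{real_algebra_1, comm_ring_1}"
proof -
  have s: "{..4} = {0, 1, 2, 3, 4::nat}" by auto
  show ?thesis by (simp add: top4_def s add_ac)
qed

definition cubic_coeffs :: "(nat \<Rightarrow> nat \<Rightarrow> real) \<Rightarrow> bool" where
  "cubic_coeffs d \<longleftrightarrow> (\<forall>i j. 3 < i + j \<longrightarrow> d i j = 0)"

lemma cubic_coeffs_dX [simp]: "cubic_coeffs (dX c)" and cubic_coeffs_dY [simp]: "cubic_coeffs (dY c)"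
  by (auto simp: cubic_coeffs_def dX_def dY_def)

lemma peval_cubic:
  fixes x y :: "'a::{real_algebra_1, comm_ring_1}"
  assumes "cubic_coeffs d"
  shows "peval d x y = of_real (d 0 0) + of_real (d 1 0) * x + of_real (d 0 1) * y
    + of_real (d 2 0) * x^2 + of_real (d 1 1) * x * y + of_real (d 0 2) * y^2
    + of_real (d 3 0) * x^3 + of_real (d 2 1) * x^2 * y + of_real (d 1 2) * x * y^2 + of_real (d 0 3) * y^3"
  using assms by (simp add: peval_expand cubic_coeffs_def)

text \<open>Divided differences along the path (x, y), (u, y), (u, v): \<open>quot_x\<close> moves x
  with y fixed, and \<open>quot_y\<close> moves y with x already at u.\<close>

definition quot_x :: "(nat \<Rightarrow> nat \<Rightarrow> real) \<Rightarrow> complex \<times> complex \<Rightarrow> complex \<times> complex \<Rightarrow> complex" where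
  "quot_x d z w = (let (x, y) = z; (u, v) = w in
     d 1 0 + d 2 0 * (x + u) + d 1 1 * y + d 3 0 * (x^2 + x * u + u^2) + d 2 1 * (x + u) * y + d 1 2 * y^2)"

definition quot_y :: "(nat \<Rightarrow> nat \<Rightarrow> real) \<Rightarrow> complex \<times> complex \<Rightarrow> complex \<times> complex \<Rightarrow> complex" where
  "quot_y d z w = (let (x, y) = z; (u, v) = w in
     d 0 1 + d 1 1 * u + d 0 2 * (y + v) + d 2 1 * u^2 + d 1 2 * u * (y + v) + d 0 3 * (y^2 + y * v + v^2))"

lemma quot_decomposition:
  assumes "cubic_coeffs d"
  shows "peval d x y - peval d u v = (x - u) * quot_x d (x, y) (u, v) + (y - v) * quot_y d (x, y) (u, v)"
  using assms
  by (simp add: peval_cubic quot_x_def quot_y_def algebra_simps power2_eq_square power3_eq_cube)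

definition bezoutian :: "(nat \<Rightarrow> nat \<Rightarrow> real) \<Rightarrow> complex \<times> complex \<Rightarrow> complex \<times> complex \<Rightarrow> complex" where
  "bezoutian c z w = quot_x (dX c) z w * quot_y (dY c) z w - quot_x (dY c) z w * quot_y (dX c) z w"

lemma quot_diagonal:
  "quot_x d (x, y) (x, y) = peval (dX d) x y" "quot_y d (x, y) (x, y) = peval (dY d) x y"
  if "cubic_coeffs d"
  using that by (simp_all add: quot_x_def quot_y_def peval_expand dX_def dY_def cubic_coeffs_def
      algebra_simps power2_eq_square numeral_2_eq_2 numeral_3_eq_3)

lemma bezoutian_diagonal: "bezoutian c (x, y) (x, y) = hessdet c x y"
  by (simp add: bezoutian_def hessdet_def quot_diagonal mult.commute)

text \<open>The nonzero vector (x - u, y - v) is in the kernel of the 2 by 2 matrix of divided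
  differences, whose determinant is the Bezoutian.\<close>

lemma bezoutian_off_diagonal:
  assumes "crit c x y" "crit c u v" "(x, y) \<noteq> (u, v)"
  shows "bezoutian c (x, y) (u, v) = 0"
proof -
  define \<alpha> \<beta> \<gamma> \<delta> where "\<alpha> = quot_x (dX c) (x, y) (u, v)" and "\<beta> = quot_y (dX c) (x, y) (u, v)"
    and "\<gamma> = quot_x (dY c) (x, y) (u, v)" and "\<delta> = quot_y (dY c) (x, y) (u, v)"
  have "(x - u) * \<alpha> + (y - v) * \<beta> = 0" "(x - u) * \<gamma> + (y - v) * \<delta> = 0"
    using assms(1,2) quot_decomposition[of "dX c" x y u v] quot_decomposition[of "dY c" x y u v]
    by (simp_all add: crit_def \<alpha>_def \<beta>_def \<gamma>_def \<delta>_def)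
  then have "(x - u) * (\<alpha> * \<delta> - \<gamma> * \<beta>) = 0" "(y - v) * (\<alpha> * \<delta> - \<gamma> * \<beta>) = 0" by algebra+
  then show ?thesis
    using assms(3) unfolding bezoutian_def \<alpha>_def \<beta>_def \<gamma>_def \<delta>_def by auto
qed

section \<open>Moments and the quadratic form they receive from the Bezoutian\<close>

definition moment :: "'i set \<Rightarrow> ('i \<Rightarrow> complex) \<Rightarrow> ('i \<Rightarrow> complex \<times> complex) \<Rightarrow> nat \<Rightarrow> nat \<Rightarrow> complex" where
  "moment A \<omega> z i j = (\<Sum>a\<in>A. \<omega> a * fst (z a) ^ i * snd (z a) ^ j)"

text \<open>The product has total degree 4 in the two points, so a term of degree at least 3 in one
  of them has degree at most 1 in the other and is annihilated. What survives has degree 2 in each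
  point, hence involves only cubic coefficients and second moments.\<close>

lemma sum_quot_product:
  assumes "moment A \<omega> z 0 0 = 0" "moment A \<omega> z 1 0 = 0" "moment A \<omega> z 0 1 = 0"
  defines "m20 \<equiv> moment A \<omega> z 2 0" and "m11 \<equiv> moment A \<omega> z 1 1" and "m02 \<equiv> moment A \<omega> z 0 2"
  shows "(\<Sum>b\<in>A. \<omega> b * (\<Sum>a\<in>A. \<omega> a * (quot_x p (z a) (z b) * quot_y q (z a) (z b)))) =
    p 3 0 * q 2 1 * m20^2 + p 3 0 * q 1 2 * m20 * m11 + p 3 0 * q 0 3 * m20 * m02
    + p 2 1 * q 2 1 * m20 * m11 + p 2 1 * q 1 2 * m11^2 + p 2 1 * q 0 3 * m11 * m02
    + p 3 0 * q 1 2 * m20 * m11 + p 3 0 * q 0 3 * m11^2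
    + p 1 2 * q 2 1 * m20 * m02 + p 1 2 * q 1 2 * m11 * m02 + p 1 2 * q 0 3 * m02^2
    + p 2 1 * q 1 2 * m20 * m02 + p 2 1 * q 0 3 * m11 * m02 + p 3 0 * q 0 3 * m20 * m02"
proof -
  let ?m = "moment A \<omega> z"
  \<comment> \<open>Summation over the first point. With (u, v) frozen, \<open>e0\<close>,
    \<open>e1\<close>, \<open>e2\<close> and \<open>f0\<close>, \<open>f2\<close> are the
    coefficients of the two quotients in degree 0 and 1 of that point.\<close>
  have inner: "(\<Sum>a\<in>A. \<omega> a * (quot_x p (z a) (u, v) * quot_y q (z a) (u, v))) =
      p 3 0 * f0 * m20 + (p 2 1 * f0 + e1 * f2) * m11 + (p 1 2 * f0 + e2 * f2 + e0 * q 0 3) * m02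
      + p 3 0 * f2 * ?m 2 1 + (p 2 1 * f2 + e1 * q 0 3) * ?m 1 2 + (p 1 2 * f2 + e2 * q 0 3) * ?m 0 3
      + p 3 0 * q 0 3 * ?m 2 2 + p 2 1 * q 0 3 * ?m 1 3 + p 1 2 * q 0 3 * ?m 0 4"
    if "e0 = p 1 0 + p 2 0 * u + p 3 0 * u^2" "e1 = p 2 0 + p 3 0 * u" "e2 = p 1 1 + p 2 1 * u"
      "f0 = q 0 1 + q 1 1 * u + q 0 2 * v + q 2 1 * u^2 + q 1 2 * u * v + q 0 3 * v^2"
      "f2 = q 0 2 + q 1 2 * u + q 0 3 * v"
    for u v e0 e1 e2 f0 f2 :: complex
  proof -
    have "quot_x p (x, y) (u, v) = e0 + e1 * x + e2 * y + p 3 0 * x^2 + p 2 1 * x * y + p 1 2 * y^2"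
      "quot_y q (x, y) (u, v) = f0 + f2 * y + q 0 3 * y^2" for x y :: complex
      unfolding that by (simp_all add: quot_x_def quot_y_def algebra_simps power2_eq_square)
    then have prod: "quot_x p (x, y) (u, v) * quot_y q (x, y) (u, v) =
      e0 * f0 + e1 * f0 * x + (e2 * f0 + e0 * f2) * y
      + p 3 0 * f0 * x^2 + (p 2 1 * f0 + e1 * f2) * (x * y) + (p 1 2 * f0 + e2 * f2 + e0 * q 0 3) * y^2
      + p 3 0 * f2 * (x^2 * y) + (p 2 1 * f2 + e1 * q 0 3) * (x * y^2) + (p 1 2 * f2 + e2 * q 0 3) * y^3
      + p 3 0 * q 0 3 * (x^2 * y^2) + p 2 1 * q 0 3 * (x * y^3) + p 1 2 * q 0 3 * y^4" for x y :: complex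
      by (simp add: algebra_simps power2_eq_square power3_eq_cube power4_eq_xxxx)
    have "\<omega> a * (quot_x p (z a) (u, v) * quot_y q (z a) (u, v)) =
      e0 * f0 * (\<omega> a * fst (z a) ^ 0 * snd (z a) ^ 0) + e1 * f0 * (\<omega> a * fst (z a) ^ 1 * snd (z a) ^ 0)
      + (e2 * f0 + e0 * f2) * (\<omega> a * fst (z a) ^ 0 * snd (z a) ^ 1)
      + p 3 0 * f0 * (\<omega> a * fst (z a) ^ 2 * snd (z a) ^ 0)
      + (p 2 1 * f0 + e1 * f2) * (\<omega> a * fst (z a) ^ 1 * snd (z a) ^ 1)
      + (p 1 2 * f0 + e2 * f2 + e0 * q 0 3) * (\<omega> a * fst (z a) ^ 0 * snd (z a) ^ 2)
      + p 3 0 * f2 * (\<omega> a * fst (z a) ^ 2 * snd (z a) ^ 1)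
      + (p 2 1 * f2 + e1 * q 0 3) * (\<omega> a * fst (z a) ^ 1 * snd (z a) ^ 2)
      + (p 1 2 * f2 + e2 * q 0 3) * (\<omega> a * fst (z a) ^ 0 * snd (z a) ^ 3)
      + p 3 0 * q 0 3 * (\<omega> a * fst (z a) ^ 2 * snd (z a) ^ 2)
      + p 2 1 * q 0 3 * (\<omega> a * fst (z a) ^ 1 * snd (z a) ^ 3)
      + p 1 2 * q 0 3 * (\<omega> a * fst (z a) ^ 0 * snd (z a) ^ 4)" for a
    proof -
      obtain x y where "z a = (x, y)" by (cases "z a")
      then show ?thesis using prod[of x y] by (simp add: distrib_left mult_ac)
    qed
    then have "(\<Sum>a\<in>A. \<omega> a * (quot_x p (z a) (u, v) * quot_y q (z a) (u, v))) =
      e0 * f0 * ?m 0 0 + e1 * f0 * ?m 1 0 + (e2 * f0 + e0 * f2) * ?m 0 1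
      + p 3 0 * f0 * ?m 2 0 + (p 2 1 * f0 + e1 * f2) * ?m 1 1 + (p 1 2 * f0 + e2 * f2 + e0 * q 0 3) * ?m 0 2
      + p 3 0 * f2 * ?m 2 1 + (p 2 1 * f2 + e1 * q 0 3) * ?m 1 2 + (p 1 2 * f2 + e2 * q 0 3) * ?m 0 3
      + p 3 0 * q 0 3 * ?m 2 2 + p 2 1 * q 0 3 * ?m 1 3 + p 1 2 * q 0 3 * ?m 0 4"
      unfolding moment_def by (simp only: sum.distrib sum_distrib_left)
    then show ?thesis unfolding assms(1-3) m20_def m11_def m02_def by simp
  qed
  \<comment> \<open>The coefficients of 1, u, v absorb all third and fourth moments. The second
    summation multiplies them by vanishing moments, which leaves \<open>k20\<close>,
    \<open>k11\<close>, \<open>k02\<close>.\<close>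
  define k00 k10 k01 where
    "k00 = q 0 1 * (p 3 0 * m20 + p 2 1 * m11 + p 1 2 * m02) + p 2 0 * q 0 2 * m11 + (p 1 1 * q 0 2 + p 1 0 * q 0 3) * m02
      + p 3 0 * q 0 2 * ?m 2 1 + (p 2 1 * q 0 2 + p 2 0 * q 0 3) * ?m 1 2 + (p 1 2 * q 0 2 + p 1 1 * q 0 3) * ?m 0 3
      + p 3 0 * q 0 3 * ?m 2 2 + p 2 1 * q 0 3 * ?m 1 3 + p 1 2 * q 0 3 * ?m 0 4"
    and "k10 = q 1 1 * (p 3 0 * m20 + p 2 1 * m11 + p 1 2 * m02) + (p 3 0 * q 0 2 + p 2 0 * q 1 2) * m11
      + (p 2 1 * q 0 2 + p 1 1 * q 1 2 + p 2 0 * q 0 3) * m02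
      + p 3 0 * q 1 2 * ?m 2 1 + (p 2 1 * q 1 2 + p 3 0 * q 0 3) * ?m 1 2 + (p 1 2 * q 1 2 + p 2 1 * q 0 3) * ?m 0 3"
    and "k01 = q 0 2 * (p 3 0 * m20 + p 2 1 * m11 + p 1 2 * m02) + p 2 0 * q 0 3 * m11 + p 1 1 * q 0 3 * m02
      + p 3 0 * q 0 3 * ?m 2 1 + p 2 1 * q 0 3 * ?m 1 2 + p 1 2 * q 0 3 * ?m 0 3"
  define L where "L = p 3 0 * m20 + p 2 1 * m11 + p 1 2 * m02"
  define k20 k11 k02 where "k20 = q 2 1 * L + p 3 0 * q 1 2 * m11 + (p 2 1 * q 1 2 + p 3 0 * q 0 3) * m02"
    and "k11 = q 1 2 * L + p 3 0 * q 0 3 * m11 + p 2 1 * q 0 3 * m02" and "k02 = q 0 3 * L"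
  have sum_a: "(\<Sum>a\<in>A. \<omega> a * (quot_x p (z a) (u, v) * quot_y q (z a) (u, v))) =
      k00 + k10 * u + k01 * v + k20 * u^2 + k11 * (u * v) + k02 * v^2" for u v
    unfolding inner[OF refl refl refl refl refl] k00_def k10_def k01_def k20_def k11_def k02_def L_def
    by (simp add: algebra_simps power2_eq_square)
  have "\<omega> b * (\<Sum>a\<in>A. \<omega> a * (quot_x p (z a) (z b) * quot_y q (z a) (z b))) =
      k00 * (\<omega> b * fst (z b) ^ 0 * snd (z b) ^ 0) + k10 * (\<omega> b * fst (z b) ^ 1 * snd (z b) ^ 0)
      + k01 * (\<omega> b * fst (z b) ^ 0 * snd (z b) ^ 1) + k20 * (\<omega> b * fst (z b) ^ 2 * snd (z b) ^ 0)
      + k11 * (\<omega> b * fst (z b) ^ 1 * snd (z b) ^ 1) + k02 * (\<omega> b * fst (z b) ^ 0 * snd (z b) ^ 2)" for b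
    by (cases "z b") (simp only: sum_a fst_conv snd_conv, simp add: algebra_simps)
  then have "(\<Sum>b\<in>A. \<omega> b * (\<Sum>a\<in>A. \<omega> a * (quot_x p (z a) (z b) * quot_y q (z a) (z b)))) =
      k00 * ?m 0 0 + k10 * ?m 1 0 + k01 * ?m 0 1 + k20 * m20 + k11 * m11 + k02 * m02"
    unfolding moment_def m20_def m11_def m02_def by (simp only: sum.distrib sum_distrib_left)
  then show ?thesis unfolding assms(1-3) k20_def k11_def k02_def L_def
    by (simp add: algebra_simps power2_eq_square)
qed

text \<open>The part of the Bezoutian quadratic in each point, contracted with the moments A, B, C
  of x^2, x y, y^2. The bracket \<open>b\<close> is a 2 by 2 minor of the cubic coefficients of the
  gradient.\<close>

definition moment_form :: "(nat \<Rightarrow> nat \<Rightarrow> real) \<Rightarrow> real \<Rightarrow> real \<Rightarrow> real \<Rightarrow> real" where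
  "moment_form c A B C = (let b = (\<lambda>(i, j) (k, l). dX c i j * dY c k l - dY c i j * dX c k l) in
     b (3, 0) (2, 1) * A^2 + 2 * b (3, 0) (1, 2) * A * B + 2 * b (3, 0) (0, 3) * A * C
     + (b (3, 0) (0, 3) + b (2, 1) (1, 2)) * B^2 + 2 * b (2, 1) (0, 3) * B * C + b (1, 2) (0, 3) * C^2)"

lemma sum_bezoutian:
  assumes "moment A \<omega> z 0 0 = 0" "moment A \<omega> z 1 0 = 0" "moment A \<omega> z 0 1 = 0"
    and "moment A \<omega> z 2 0 = of_real m20" "moment A \<omega> z 1 1 = of_real m11" "moment A \<omega> z 0 2 = of_real m02"
  shows "(\<Sum>b\<in>A. \<Sum>a\<in>A. \<omega> a * \<omega> b * bezoutian c (z a) (z b)) = of_real (moment_form c m20 m11 m02)"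
proof -
  have "(\<Sum>b\<in>A. \<Sum>a\<in>A. \<omega> a * \<omega> b * bezoutian c (z a) (z b)) =
    (\<Sum>b\<in>A. \<omega> b * (\<Sum>a\<in>A. \<omega> a * (quot_x (dX c) (z a) (z b) * quot_y (dY c) (z a) (z b))))
    - (\<Sum>b\<in>A. \<omega> b * (\<Sum>a\<in>A. \<omega> a * (quot_x (dY c) (z a) (z b) * quot_y (dX c) (z a) (z b))))"
    by (simp add: bezoutian_def sum_distrib_left right_diff_distrib mult_ac flip: sum_subtractf)
  also have "\<dots> = of_real (moment_form c m20 m11 m02)"
    unfolding sum_quot_product[OF assms(1-3)] assms(4-6) moment_form_def
    by (simp add: algebra_simps power2_eq_square)
  finally show ?thesis .
qed

lemma gradient_top_coeffs:
  "dX c 3 0 = 4 * c 4 0" "dX c 2 1 = 3 * c 3 1" "dX c 1 2 = 2 * c 2 2" "dX c 0 3 = c 1 3"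
  "dY c 3 0 = c 3 1" "dY c 2 1 = 2 * c 2 2" "dY c 1 2 = 3 * c 1 3" "dY c 0 3 = 4 * c 0 4"
  by (simp_all add: dX_def dY_def eval_nat_numeral)

lemma top4_product_coeffs:
  fixes a b :: "nat \<Rightarrow> real"
  assumes "\<And>x y :: real. top4 c x y = (\<Prod>k<4. a k * x + b k * y)"
  shows "c 0 4 = b 0 * b 1 * b 2 * b 3"
    "c 1 3 = a 0 * b 1 * b 2 * b 3 + b 0 * a 1 * b 2 * b 3 + b 0 * b 1 * a 2 * b 3 + b 0 * b 1 * b 2 * a 3"
    "c 2 2 = a 0 * a 1 * b 2 * b 3 + a 0 * b 1 * a 2 * b 3 + a 0 * b 1 * b 2 * a 3
      + b 0 * a 1 * a 2 * b 3 + b 0 * a 1 * b 2 * a 3 + b 0 * b 1 * a 2 * a 3"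
    "c 3 1 = a 0 * a 1 * a 2 * b 3 + a 0 * a 1 * b 2 * a 3 + a 0 * b 1 * a 2 * a 3 + b 0 * a 1 * a 2 * a 3"
    "c 4 0 = a 0 * a 1 * a 2 * a 3"
proof -
  have "poly [:c 0 4, c 1 3, c 2 2, c 3 1, c 4 0:] x =
      poly ([:b 0, a 0:] * [:b 1, a 1:] * [:b 2, a 2:] * [:b 3, a 3:]) x" for x
    using assms[of x 1] by (simp add: top4_expand eval_nat_numeral algebra_simps)
  then have "[:c 0 4, c 1 3, c 2 2, c 3 1, c 4 0:] = [:b 0, a 0:] * [:b 1, a 1:] * [:b 2, a 2:] * [:b 3, a 3:]"
    by (rule poly_ext)
  then show "c 0 4 = b 0 * b 1 * b 2 * b 3"
    "c 1 3 = a 0 * b 1 * b 2 * b 3 + b 0 * a 1 * b 2 * b 3 + b 0 * b 1 * a 2 * b 3 + b 0 * b 1 * b 2 * a 3"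
    "c 2 2 = a 0 * a 1 * b 2 * b 3 + a 0 * b 1 * a 2 * b 3 + a 0 * b 1 * b 2 * a 3
      + b 0 * a 1 * a 2 * b 3 + b 0 * a 1 * b 2 * a 3 + b 0 * b 1 * a 2 * a 3"
    "c 3 1 = a 0 * a 1 * a 2 * b 3 + a 0 * a 1 * b 2 * a 3 + a 0 * b 1 * a 2 * a 3 + b 0 * a 1 * a 2 * a 3"
    "c 4 0 = a 0 * a 1 * a 2 * a 3"
    by (simp_all add: algebra_simps)
qed

text \<open>By the product rule the gradient is the sum of (a k, b k) times the product of the other
  three linear forms, so the Bezoutian is a sum over pairs i < j with factor \<open>D i j\<close>.
  The two cubics of a pair share the remaining two linear forms; this yields a second factor
  \<open>D i j\<close> and the square of the moment functional at the product of these two, which is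
  \<open>m\<close>.\<close>

lemma moment_form_product_of_lines:
  fixes a b :: "nat \<Rightarrow> real"
  assumes "\<And>x y :: real. top4 c x y = (\<Prod>k<4. a k * x + b k * y)"
  shows "moment_form c A B C \<le> 0"
proof -
  define D where "D i j = a i * b j - a j * b i" for i j
  define m where "m i j = a i * a j * A + (a i * b j + a j * b i) * B + b i * b j * C" for i j
  have "moment_form c A B C = - ((D 0 1 * m 2 3)^2 + (D 0 2 * m 1 3)^2 + (D 0 3 * m 1 2)^2
      + (D 1 2 * m 0 3)^2 + (D 1 3 * m 0 2)^2 + (D 2 3 * m 0 1)^2)"
    unfolding moment_form_def D_def m_def Let_def split gradient_top_coeffs
      top4_product_coeffs[OF assms] by algebra
  also have "\<dots> \<le> 0"
    unfolding neg_le_0_iff_le by (intro add_nonneg_nonneg zero_le_power2)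
  finally show ?thesis .
qed

section \<open>Counting the critical points by sign\<close>

lemma top4_form:
  "top4 c x y = form 4 [:of_real (c 0 4), of_real (c 1 3), of_real (c 2 2), of_real (c 3 1), of_real (c 4 0):] x y"
  for x y :: "'a::{real_algebra_1, comm_ring_1}"
proof -
  have s: "{..4} = {0, 1, 2, 3, 4::nat}" by auto
  show ?thesis by (simp add: top4_expand form_def s eval_nat_numeral add_ac mult_ac)
qed

text \<open>The given lines are affine. One that missed the origin would by homogeneity make the
  leading form vanish in all directions but one, hence identically, contrary to nondegeneracy.
  Distinct lines through the origin are independent, and their equations divide the form.\<close>

lemma four_real_lines_product:
  assumes "nondegenerate4 c" "four_real_lines c"
  obtains a b :: "nat \<Rightarrow> real" where "\<And>x y :: real. top4 c x y = (\<Prod>k<4. a k * x + b k * y)"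
    "\<And>k l. k < 4 \<Longrightarrow> l < 4 \<Longrightarrow> k \<noteq> l \<Longrightarrow> a k * b l \<noteq> a l * b k"
proof -
  define p where "p = [:c 0 4, c 1 3, c 2 2, c 3 1, c 4 0:]"
  have top: "top4 c x y = form 4 p x y" for x y :: real by (simp add: top4_form p_def)
  have deg: "degree p \<le> 4" by (simp add: p_def)
  have "p \<noteq> 0"
  proof
    assume "p = 0"
    then have zero: "top4 c x y = 0" for x y :: complex by (simp add: top4_expand p_def)
    obtain a b :: "nat \<Rightarrow> complex" where ab: "\<forall>x y. top4 c x y = (\<Prod>k<4. a k * x + b k * y)"
      "\<forall>k<4. \<forall>l<4. k \<noteq> l \<longrightarrow> a k * b l \<noteq> a l * b k"
      using assms(1) unfolding nondegenerate4_def by (elim exE conjE)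
    have "poly (\<Prod>k<4. [:a k, b k:]) t = 0" for t
      using ab(1)[rule_format, of 1 t] zero[of 1 t] by (simp add: poly_prod mult.commute)
    then have "(\<Prod>k<4. [:a k, b k:]) = 0" by (simp add: poly_all_0_iff_0[symmetric])
    then obtain k where "k < 4" "a k = 0" "b k = 0" by auto
    with ab(2)[rule_format, of k 0] ab(2)[rule_format, of k 1] show False by (cases "k = 0") auto
  qed
  obtain a b d :: "nat \<Rightarrow> real" where
    abd: "\<forall>k<4. (a k, b k) \<noteq> (0, 0)"
      "\<forall>k<4. \<forall>l<4. k \<noteq> l \<longrightarrow>
        {(x, y). a k * x + b k * y = d k} \<noteq> {(x, y). a l * x + b l * y = d l}"
      "\<forall>k<4. \<forall>x y :: real. a k * x + b k * y = d k \<longrightarrow> top4 c x y = 0"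
    using assms(2) unfolding four_real_lines_def by (elim exE conjE)
  note nonzero = abd(1)[rule_format] and distinct = abd(2)[rule_format]
    and vanish = abd(3)[rule_format, unfolded top]
  have d0: "d k = 0" if k: "k < 4" for k
  proof (rule ccontr)
    assume d: "d k \<noteq> 0"
    \<comment> \<open>The extra factor takes care of the direction parallel to the line, which no
      multiple of a point on the line reaches.\<close>
    have "poly (p * [:b k, a k:]) t = 0" for t
    proof (cases "a k * t + b k = 0")
      case False
      define s where "s = d k / (a k * t + b k)"
      have "a k * (s * t) + b k * (s * 1) = s * (a k * t + b k)" by (simp add: algebra_simps)
      also have "\<dots> = d k" using False by (simp add: s_def)
      finally have "form 4 p (s * t) (s * 1) = 0" by (rule vanish[OF k])
      then have "s ^ 4 * form 4 p t 1 = 0" by (simp only: form_homogeneous)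
      moreover have "s \<noteq> 0" using d False by (simp add: s_def)
      ultimately show ?thesis using deg by (simp add: form_eq_poly)
    qed (simp only: poly_mult, simp add: mult.commute add.commute)
    then have "p * [:b k, a k:] = 0" by (simp only: poly_all_0_iff_0[symmetric] simp_thms)
    with \<open>p \<noteq> 0\<close> nonzero[OF k] show False by (auto simp del: mult_pCons_right)
  qed
  have indep: "a k * b l \<noteq> a l * b k" if kl: "k < 4" "l < 4" "k \<noteq> l" for k l
  proof
    assume eq: "a k * b l = a l * b k"
    have "a k * x + b k * y = 0 \<longleftrightarrow> a l * x + b l * y = 0" for x y
    proof -
      have "a l * (a k * x + b k * y) = a k * (a l * x + b l * y)" "b l * (a k * x + b k * y) = b k * (a l * x + b l * y)"
        using eq by algebra+
      then show ?thesis using nonzero[OF kl(1)] nonzero[OF kl(2)] by auto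
    qed
    with distinct[OF kl] d0 kl show False by simp
  qed
  have "\<exists>C. \<forall>x y. form 4 p x y = C * (\<Prod>k<4. a k * x - (- b k) * y)"
  proof (rule form_vanishing_factor[OF deg])
    show "form 4 p (- b k) (a k) = 0" if "k < 4" for k
      using vanish[OF that] d0[OF that] by (simp add: mult.commute)
  qed (use nonzero indep in \<open>force simp: mult.commute\<close>)+
  then obtain C where C: "\<And>x y. form 4 p x y = C * (\<Prod>k<4. a k * x + b k * y)" by auto
  have "C \<noteq> 0"
  proof
    assume "C = 0"
    then have "poly p t = 0" for t using C[of t 1] form_eq_poly[OF deg, of 1 t] by simp
    with \<open>p \<noteq> 0\<close> show False by (simp add: poly_all_0_iff_0[symmetric])
  qed
  show ?thesis
  \<comment> \<open>The constant \<open>C\<close> is absorbed into the first linear factor.\<close>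
  proof (rule that[of "a(0 := C * a 0)" "b(0 := C * b 0)"])
    show "top4 c x y = (\<Prod>k<4. (a(0 := C * a 0)) k * x + (b(0 := C * b 0)) k * y)" for x y :: real
      unfolding top C by (simp add: eval_nat_numeral algebra_simps)
  qed (use indep \<open>C \<noteq> 0\<close> in auto)
qed

definition cubic_top :: "(nat \<Rightarrow> nat \<Rightarrow> real) \<Rightarrow> complex poly" where
  "cubic_top d = [:of_real (d 0 3), of_real (d 1 2), of_real (d 2 1), of_real (d 3 0):]"

lemma form_cubic_top:
  "form 3 (cubic_top d) x y = d 3 0 * x^3 + d 2 1 * x^2 * y + d 1 2 * x * y^2 + d 0 3 * y^3"
proof -
  have s: "{..3} = {0, 1, 2, 3::nat}" by auto
  show ?thesis by (simp add: form_def cubic_top_def s eval_nat_numeral)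
qed

text \<open>By Euler's relation one of the four linear forms vanishes. Then the gradient reduces to
  (a i, b i) times the product of the other three, so a second one vanishes, and two independent
  forms vanish together only at the origin.\<close>

lemma gradient_top_no_common_zero:
  fixes a b :: "nat \<Rightarrow> real" and x y :: complex
  assumes top: "\<And>x y :: real. top4 c x y = (\<Prod>k<4. a k * x + b k * y)"
    and indep: "\<And>k l. k < 4 \<Longrightarrow> l < 4 \<Longrightarrow> k \<noteq> l \<Longrightarrow> a k * b l \<noteq> a l * b k"
    and zero: "form 3 (cubic_top (dX c)) x y = 0" "form 3 (cubic_top (dY c)) x y = 0"
  shows "x = 0 \<and> y = 0"
proof -
  define l where "l k = a k * x + b k * y" for k
  have P: "a 0 * (l 1 * l 2 * l 3) + a 1 * (l 0 * l 2 * l 3) + a 2 * (l 0 * l 1 * l 3) + a 3 * (l 0 * l 1 * l 2) = 0"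
    and Q: "b 0 * (l 1 * l 2 * l 3) + b 1 * (l 0 * l 2 * l 3) + b 2 * (l 0 * l 1 * l 3) + b 3 * (l 0 * l 1 * l 2) = 0"
    using zero unfolding form_cubic_top gradient_top_coeffs top4_product_coeffs[OF top] l_def
    by (simp_all add: algebra_simps power2_eq_square power3_eq_cube)
  have two: ?thesis if "l i = 0" "l j = 0" "i < 4" "j < 4" "i \<noteq> j" for i j
  proof -
    have "(a i * b j - a j * b i) * x = 0" "(a i * b j - a j * b i) * y = 0"
      using that(1,2) unfolding l_def of_real_diff of_real_mult by algebra+
    moreover have "complex_of_real (a i * b j - a j * b i) \<noteq> 0"
      using indep[OF that(3-5)] by (simp only: of_real_eq_0_iff)
    ultimately show ?thesis by simp
  qed
  have one: ?thesis if "l i = 0" "i < 4" "a i * m = 0" "b i * m = 0" "m = 0 \<Longrightarrow> \<exists>j<4. j \<noteq> i \<and> l j = 0"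
    for i and m :: complex
  proof -
    have "a i \<noteq> 0 \<or> b i \<noteq> 0" using indep[OF \<open>i < 4\<close>, of 0] indep[OF \<open>i < 4\<close>, of 1] by (cases "i = 0") auto
    with that(3,4) have "m = 0" by auto
    with that(1,2,5) two show ?thesis by blast
  qed
  have "4 * (l 0 * l 1 * l 2 * l 3) =
      x * (a 0 * (l 1 * l 2 * l 3) + a 1 * (l 0 * l 2 * l 3) + a 2 * (l 0 * l 1 * l 3) + a 3 * (l 0 * l 1 * l 2))
      + y * (b 0 * (l 1 * l 2 * l 3) + b 1 * (l 0 * l 2 * l 3) + b 2 * (l 0 * l 1 * l 3) + b 3 * (l 0 * l 1 * l 2))"
    unfolding l_def by (simp add: algebra_simps)
  then have "l 0 * l 1 * l 2 * l 3 = 0" unfolding P Q by simp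
  then consider "l 0 = 0" | "l 1 = 0" | "l 2 = 0" | "l 3 = 0" by auto
  then show ?thesis
  proof cases
    case 1
    then show ?thesis using P Q by (intro one[of 0 "l 1 * l 2 * l 3"]) (auto intro: exI[of _ 1] exI[of _ 2] exI[of _ 3])
  next
    case 2
    then show ?thesis using P Q by (intro one[of 1 "l 0 * l 2 * l 3"]) (auto intro: exI[of _ 0] exI[of _ 2] exI[of _ 3])
  next
    case 3
    then show ?thesis using P Q by (intro one[of 2 "l 0 * l 1 * l 3"]) (auto intro: exI[of _ 0] exI[of _ 1] exI[of _ 3])
  next
    case 4
    then show ?thesis using P Q by (intro one[of 3 "l 0 * l 1 * l 2"]) (auto intro: exI[of _ 0] exI[of _ 1] exI[of _ 2])
  qed
qed

lemma complex_coprime_if_no_common_root: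
  fixes p q :: "complex poly"
  assumes "p \<noteq> 0" "\<And>z. poly p z = 0 \<Longrightarrow> poly q z \<noteq> 0"
  shows "coprime p q"
proof (rule coprimeI)
  fix d assume d: "d dvd p" "d dvd q"
  with assms(1) have "d \<noteq> 0" by auto
  moreover have "poly d z \<noteq> 0" for z
    using assms(2)[of z] d by (auto elim!: dvdE)
  then have "constant (poly d)" using fundamental_theorem_of_algebra by blast
  ultimately show "is_unit d" by (simp add: constant_degree is_unit_iff_degree)
qed

section \<open>Critical points when the leading form splits over the reals\<close>

locale hyperbolic_morse =
  fixes c :: "nat \<Rightarrow> nat \<Rightarrow> real" and a b :: "nat \<Rightarrow> real"
  assumes simple_crit: "\<And>x y :: complex. crit c x y \<Longrightarrow> hessdet c x y \<noteq> 0"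
    and top: "\<And>x y :: real. top4 c x y = (\<Prod>k<4. a k * x + b k * y)"
    and indep: "\<And>k l. k < 4 \<Longrightarrow> l < 4 \<Longrightarrow> k \<noteq> l \<Longrightarrow> a k * b l \<noteq> a l * b k"
begin

definition Z :: "(complex \<times> complex) set" where
  "Z = {(x, y). crit c x y}"

text \<open>The divided differences based at a critical point provide the decomposition demanded by
  \<open>simple\<close>; its determinant is the Bezoutian on the diagonal, that is, the Hessian
  determinant.\<close>

lemma card_Z_ge:
  assumes "finite Z"
  shows "9 \<le> card Z"
proof -
  define low where "low d x y = form 2 [:of_real (d 0 2), of_real (d 1 1), of_real (d 2 0):] x y
      + (form 1 [:of_real (d 0 1), of_real (d 1 0):] x y + form 0 [:of_real (d 0 0):] x y)"
    for d :: "nat \<Rightarrow> nat \<Rightarrow> real" and x y :: complex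
  have low: "low d \<in> poly_fun 2" for d
    unfolding low_def[abs_def] by (intro poly_fun_add form_in_poly_fun) simp_all
  have split: "peval d x y = form 3 (cubic_top d) x y + low d x y" if "cubic_coeffs d" for d and x y :: complex
    unfolding peval_cubic[OF that] form_cubic_top low_def by (simp add: form_def eval_nat_numeral)
  let ?p = "cubic_top (dX c)" and ?q = "cubic_top (dY c)"
  have no_zero: "x = 0 \<and> y = 0" if "form 3 ?p x y = 0" "form 3 ?q x y = 0" for x y
    using gradient_top_no_common_zero[OF top indep that] .
  have deg: "degree ?p \<le> 3" "degree ?q \<le> 3" by (simp_all add: cubic_top_def)
  have "coeff ?p 3 \<noteq> 0 \<or> coeff ?q 3 \<noteq> 0"
    using no_zero[of 1 0] by (auto simp: form_0_right)
  then have deg3: "degree ?p = 3 \<or> degree ?q = 3"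
    using deg le_degree[of ?p 3] le_degree[of ?q 3] by auto
  have no_root: "poly ?p z \<noteq> 0 \<or> poly ?q z \<noteq> 0" for z
    using no_zero[of z 1] form_eq_poly[OF deg(1), of 1 z] form_eq_poly[OF deg(2), of 1 z] by auto
  have "coprime ?p ?q"
  proof (cases "?p = 0")
    case True
    then have "poly ?q z \<noteq> 0" for z using no_root[of z] by simp
    then have "constant (poly ?q)" using fundamental_theorem_of_algebra by blast
    with True deg3 show ?thesis by (simp add: constant_degree)
  qed (use no_root complex_coprime_if_no_common_root in blast)
  interpret simple_coprime_cubics "peval (dX c)" "peval (dY c)" "low (dX c)" "low (dY c)" ?p ?q
  proof unfold_locales
    show "peval (dX c) x y = form 3 ?p x y + low (dX c) x y" "peval (dY c) x y = form 3 ?q x y + low (dY c) x y" for x y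
      by (simp_all add: split)
    fix u v :: complex
    assume uv: "peval (dX c) u v = 0" "peval (dY c) u v = 0"
    then have "bezoutian c (u, v) (u, v) \<noteq> 0"
      using simple_crit[of u v] by (simp add: bezoutian_diagonal crit_def)
    moreover have "(\<lambda>x y. quot_x d (x, y) (u, v)) \<in> poly_funs" "(\<lambda>x y. quot_y d (x, y) (u, v)) \<in> poly_funs" for d
      by (simp_all add: quot_x_def quot_y_def)
    moreover have "peval (dX c) x y = (x - u) * quot_x (dX c) (x, y) (u, v) + (y - v) * quot_y (dX c) (x, y) (u, v)"
      "peval (dY c) x y = (x - u) * quot_x (dY c) (x, y) (u, v) + (y - v) * quot_y (dY c) (x, y) (u, v)" for x y
      using quot_decomposition[of "dX c" x y u v] quot_decomposition[of "dY c" x y u v] uv by simp_all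
    ultimately show "\<exists>\<alpha>\<in>poly_funs. \<exists>\<beta>\<in>poly_funs. \<exists>\<gamma>\<in>poly_funs. \<exists>\<delta>\<in>poly_funs.
      (\<forall>x y. peval (dX c) x y = (x - u) * \<alpha> x y + (y - v) * \<beta> x y) \<and>
      (\<forall>x y. peval (dY c) x y = (x - u) * \<gamma> x y + (y - v) * \<delta> x y) \<and>
      \<alpha> u v * \<delta> u v - \<beta> u v * \<gamma> u v \<noteq> 0"
      by (intro bexI[of _ "\<lambda>x y. quot_x (dX c) (x, y) (u, v)"] bexI[of _ "\<lambda>x y. quot_y (dX c) (x, y) (u, v)"]
          bexI[of _ "\<lambda>x y. quot_x (dY c) (x, y) (u, v)"] bexI[of _ "\<lambda>x y. quot_y (dY c) (x, y) (u, v)"])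
        (auto simp: bezoutian_def mult.commute)
  qed (use low deg deg3 \<open>coprime ?p ?q\<close> in auto)
  show ?thesis using card_common_zeros_ge assms by (simp add: Z_def crit_def)
qed

definition conj :: "complex \<times> complex \<Rightarrow> complex \<times> complex" where
  "conj k = (cnj (fst k), cnj (snd k))"

lemma conj_conj [simp]: "conj (conj k) = k" by (simp add: conj_def)

lemma conj_Z: "k \<in> Z \<Longrightarrow> conj k \<in> Z"
proof -
  have "peval d (cnj x) (cnj y) = cnj (peval d x y)" for d x y by (simp add: peval_def)
  then show "k \<in> Z \<Longrightarrow> conj k \<in> Z" by (auto simp: Z_def conj_def crit_def)
qed

lemma bezoutian_conj: "bezoutian c (conj k) (conj l) = cnj (bezoutian c k l)"
  by (simp add: bezoutian_def quot_x_def quot_y_def conj_def split_def)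

lemma bezoutian_Z: "k \<in> Z \<Longrightarrow> l \<in> Z \<Longrightarrow> k \<noteq> l \<Longrightarrow> bezoutian c k l = 0"
  using bezoutian_off_diagonal by (force simp: Z_def)

text \<open>Each point is listed together with its conjugate, to make the weights
  conjugation-symmetric. A real point is thereby listed twice.\<close>

definition pt :: "(complex \<times> complex) \<times> bool \<Rightarrow> complex \<times> complex" where
  "pt = (\<lambda>(k, s). if s then k else conj k)"

text \<open>Real combinations of conjugation-symmetric weights on the critical points diagonalise the
  Bezoutian, since it vanishes at pairs of distinct critical points.\<close>

lemma sum_weights_eq_moment_form:
  fixes z :: "complex \<times> complex \<Rightarrow> complex" and r \<epsilon> :: "complex \<times> complex \<Rightarrow> real"
  assumes K: "finite K" "K \<subseteq> Z" and sep: "\<And>k l. k \<in> K \<Longrightarrow> l \<in> K \<Longrightarrow> k \<noteq> l \<Longrightarrow> conj k \<noteq> l"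
    and \<epsilon>: "\<And>k. k \<in> K \<Longrightarrow> (z k)\<^sup>2 * bezoutian c k k + (cnj (z k))\<^sup>2 * bezoutian c (conj k) (conj k)
      + z k * cnj (z k) * (bezoutian c k (conj k) + bezoutian c (conj k) k) = of_real (\<epsilon> k)"
  defines "m i j \<equiv> \<Sum>k\<in>K. 2 * Re (z k * fst k ^ i * snd k ^ j) * r k"
  assumes "m 0 0 = 0" "m 1 0 = 0" "m 0 1 = 0"
  shows "(\<Sum>k\<in>K. (r k)\<^sup>2 * \<epsilon> k) = moment_form c (m 2 0) (m 1 1) (m 0 2)"
proof -
  define wt where "wt = (\<lambda>(k, s). if s then z k else cnj (z k))"
  define \<omega> where "\<omega> = (\<lambda>(k, s). complex_of_real (r k) * wt (k, s))"
  let ?A = "K \<times> (UNIV :: bool set)"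
  have sum_A: "(\<Sum>b\<in>?A. f b) = (\<Sum>k\<in>K. \<Sum>s\<in>UNIV. f (k, s))" for f :: "_ \<Rightarrow> complex"
    by (simp add: sum.cartesian_product)
  have moment: "moment ?A \<omega> pt i j = of_real (m i j)" for i j
  proof -
    have "moment ?A \<omega> pt i j = (\<Sum>k\<in>K. \<Sum>s\<in>UNIV. \<omega> (k, s) * fst (pt (k, s)) ^ i * snd (pt (k, s)) ^ j)"
      unfolding moment_def by (rule sum_A)
    also have "\<dots> = (\<Sum>k\<in>K. of_real (2 * Re (z k * fst k ^ i * snd k ^ j) * r k))"
    proof (rule sum.cong)
      fix k
      have "(\<Sum>s\<in>UNIV. \<omega> (k, s) * fst (pt (k, s)) ^ i * snd (pt (k, s)) ^ j)
          = r k * (z k * fst k ^ i * snd k ^ j + cnj (z k * fst k ^ i * snd k ^ j))"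
        by (simp add: UNIV_bool \<omega>_def wt_def pt_def conj_def algebra_simps)
      then show "(\<Sum>s\<in>UNIV. \<omega> (k, s) * fst (pt (k, s)) ^ i * snd (pt (k, s)) ^ j)
          = of_real (2 * Re (z k * fst k ^ i * snd k ^ j) * r k)"
        by (simp only: complex_add_cnj of_real_mult mult.commute)
    qed simp
    finally show ?thesis by (simp add: m_def)
  qed
  \<comment> \<open>Distinct elements of \<open>K\<close> are not conjugate to each other, so for l
    \<noteq> k the block contains only pairs of distinct critical points.\<close>
  have block: "(\<Sum>s\<in>UNIV. \<Sum>t\<in>UNIV. \<omega> (l, t) * \<omega> (k, s) * bezoutian c (pt (l, t)) (pt (k, s)))
      = (if l = k then of_real ((r k)\<^sup>2 * \<epsilon> k) else 0)" if "k \<in> K" "l \<in> K" for k l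
  proof (cases "l = k")
    case True
    have "(\<Sum>s\<in>UNIV. \<Sum>t\<in>UNIV. \<omega> (k, t) * \<omega> (k, s) * bezoutian c (pt (k, t)) (pt (k, s))) =
      of_real ((r k)\<^sup>2) * ((z k)\<^sup>2 * bezoutian c k k + (cnj (z k))\<^sup>2 * bezoutian c (conj k) (conj k)
      + z k * cnj (z k) * (bezoutian c k (conj k) + bezoutian c (conj k) k))"
      by (simp add: UNIV_bool \<omega>_def wt_def pt_def algebra_simps power2_eq_square)
    then show ?thesis using True \<epsilon>[OF that(1)] by simp
  next
    case False
    have "conj l \<noteq> conj k" using False conj_conj by metis
    then have "pt (l, t) \<noteq> pt (k, s)" for s t
      using sep[OF that] sep[OF that(2,1)] False conj_conj[of k] conj_conj[of l] by (auto simp: pt_def)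
    moreover have "pt (l, t) \<in> Z" "pt (k, s) \<in> Z" for s t
      using that[THEN subsetD[OF K(2)]] by (simp_all add: pt_def conj_Z)
    ultimately show ?thesis using False bezoutian_Z by simp
  qed
  have "complex_of_real (moment_form c (m 2 0) (m 1 1) (m 0 2))
      = (\<Sum>b\<in>?A. \<Sum>a\<in>?A. \<omega> a * \<omega> b * bezoutian c (pt a) (pt b))"
    using assms(6-8) by (intro sum_bezoutian[symmetric]) (simp_all add: moment)
  also have "\<dots> = (\<Sum>k\<in>K. \<Sum>s\<in>UNIV. \<Sum>l\<in>K. \<Sum>t\<in>UNIV. \<omega> (l, t) * \<omega> (k, s) * bezoutian c (pt (l, t)) (pt (k, s)))"
    by (simp only: sum_A)
  also have "\<dots> = (\<Sum>k\<in>K. \<Sum>l\<in>K. \<Sum>s\<in>UNIV. \<Sum>t\<in>UNIV. \<omega> (l, t) * \<omega> (k, s) * bezoutian c (pt (l, t)) (pt (k, s)))"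
    by (intro sum.cong refl sum.swap)
  also have "\<dots> = (\<Sum>k\<in>K. \<Sum>l\<in>K. if l = k then of_real ((r k)\<^sup>2 * \<epsilon> k) else 0)"
    by (intro sum.cong refl block)
  also have "\<dots> = of_real (\<Sum>k\<in>K. (r k)\<^sup>2 * \<epsilon> k)"
    using K(1) by simp
  finally show ?thesis by (simp only: of_real_eq_iff)
qed

lemma moment_form_le_0: "moment_form c A B C \<le> 0"
  using top by (rule moment_form_product_of_lines)

text \<open>Four weights can satisfy the three conditions in degree at most 1 nontrivially, and then
  a positive sum would be at most 0. Seven weights can annihilate the second moments as well, and
  then a negative sum would be 0.\<close>

lemma card_weights_le:
  fixes z :: "complex \<times> complex \<Rightarrow> complex" and \<epsilon> :: "complex \<times> complex \<Rightarrow> real"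
  assumes K: "finite K" "K \<subseteq> Z" and sep: "\<And>k l. k \<in> K \<Longrightarrow> l \<in> K \<Longrightarrow> k \<noteq> l \<Longrightarrow> conj k \<noteq> l"
    and \<epsilon>: "\<And>k. k \<in> K \<Longrightarrow> (z k)\<^sup>2 * bezoutian c k k + (cnj (z k))\<^sup>2 * bezoutian c (conj k) (conj k)
      + z k * cnj (z k) * (bezoutian c k (conj k) + bezoutian c (conj k) k) = of_real (\<epsilon> k)"
  shows "(\<And>k. k \<in> K \<Longrightarrow> 0 < \<epsilon> k) \<Longrightarrow> card K \<le> 3" "(\<And>k. k \<in> K \<Longrightarrow> \<epsilon> k < 0) \<Longrightarrow> card K \<le> 6"
proof -
  define A where "A = (\<lambda>(i, j) k. 2 * Re (z k * fst k ^ i * snd k ^ j))"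
  show "card K \<le> 3" if pos: "\<And>k. k \<in> K \<Longrightarrow> 0 < \<epsilon> k"
  proof (rule ccontr)
    assume "\<not> card K \<le> 3"
    then obtain r where r: "\<exists>k\<in>K. r k \<noteq> 0"
      "\<And>e. e \<in> {(0, 0), (1, 0), (0, 1)} \<Longrightarrow> (\<Sum>k\<in>K. A e k * r k) = 0"
      using homogeneous_system_nontrivial[of "{(0, 0), (1, 0), (0, 1)}" K A] K(1) by auto
    have "(\<Sum>k\<in>K. (r k)\<^sup>2 * \<epsilon> k) \<le> 0"
      using r(2)[of "(0, 0)"] r(2)[of "(1, 0)"] r(2)[of "(0, 1)"] moment_form_le_0
      by (subst sum_weights_eq_moment_form[OF K sep \<epsilon>]) (simp_all add: A_def)
    moreover have "0 < (\<Sum>k\<in>K. (r k)\<^sup>2 * \<epsilon> k)"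
      using r(1) K(1) by (auto intro!: sum_pos2 simp: pos less_imp_le)
    ultimately show False by simp
  qed
  show "card K \<le> 6" if neg: "\<And>k. k \<in> K \<Longrightarrow> \<epsilon> k < 0"
  proof (rule ccontr)
    assume "\<not> card K \<le> 6"
    then obtain r where r: "\<exists>k\<in>K. r k \<noteq> 0"
      "\<And>e. e \<in> {(0, 0), (1, 0), (0, 1), (2, 0), (1, 1), (0, 2)} \<Longrightarrow> (\<Sum>k\<in>K. A e k * r k) = 0"
      using homogeneous_system_nontrivial[of "{(0, 0), (1, 0), (0, 1), (2, 0), (1, 1), (0, 2)}" K A] K(1) by auto
    have "(\<Sum>k\<in>K. (r k)\<^sup>2 * \<epsilon> k) = 0"
      using r(2)[of "(0, 0)"] r(2)[of "(1, 0)"] r(2)[of "(0, 1)"] r(2)[of "(2, 0)"] r(2)[of "(1, 1)"] r(2)[of "(0, 2)"]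
      by (subst sum_weights_eq_moment_form[OF K sep \<epsilon>]) (simp_all add: A_def moment_form_def)
    moreover have "0 < (\<Sum>k\<in>K. (r k)\<^sup>2 * - \<epsilon> k)"
      using r(1) K(1) by (auto intro!: sum_pos2 simp: neg less_imp_le mult_nonneg_nonpos mult_pos_neg)
    ultimately show False by (simp add: sum_negf)
  qed
qed

section \<open>Real critical points and conjugate pairs\<close>

definition emb :: "real \<times> real \<Rightarrow> complex \<times> complex" where
  "emb p = (of_real (fst p), of_real (snd p))"

definition crit_pos :: "(real \<times> real) set" where
  "crit_pos = {(x, y). crit c x y \<and> 0 < hessdet c x y}"

definition crit_neg :: "(real \<times> real) set" where
  "crit_neg = {(x, y). crit c x y \<and> hessdet c x y < 0}"

text \<open>One representative of each nonreal conjugate pair, chosen by its first nonzero imaginary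
  part.\<close>

definition upper :: "(complex \<times> complex) set" where
  "upper = {(x, y) \<in> Z. 0 < Im x \<or> Im x = 0 \<and> 0 < Im y}"

lemma peval_of_real: "peval d (complex_of_real x) (of_real y) = of_real (peval d x y)"
  by (simp add: peval_def)

lemma emb_Z: "emb (x, y) \<in> Z \<longleftrightarrow> crit c x y"
  by (simp add: emb_def Z_def crit_def peval_of_real)

lemma inj_emb: "inj emb"
  by (auto simp: inj_def emb_def)

lemma bezoutian_emb: "bezoutian c (emb (x, y)) (emb (x, y)) = of_real (hessdet c x y)"
  by (simp add: emb_def bezoutian_diagonal hessdet_def peval_of_real)

lemma crit_real_cases: "crit c x y \<Longrightarrow> (x, y) \<in> crit_pos \<or> (x, y) \<in> crit_neg" for x y :: real
proof -
  assume "crit c x y"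
  then have "crit c (complex_of_real x) (of_real y)" by (simp add: crit_def peval_of_real)
  then have "hessdet c (complex_of_real x) (of_real y) \<noteq> 0" by (rule simple_crit)
  then have "hessdet c x y \<noteq> 0" by (auto simp: hessdet_def peval_of_real simp flip: of_real_mult of_real_diff)
  then show ?thesis using \<open>crit c x y\<close> by (auto simp: crit_pos_def crit_neg_def)
qed

lemma Z_cases: "Z = emb ` crit_pos \<union> emb ` crit_neg \<union> upper \<union> conj ` upper"
proof (intro equalityI subsetI)
  fix k assume k: "k \<in> Z"
  obtain x y where xy: "k = (x, y)" by (cases k)
  consider "Im x = 0" "Im y = 0" | "0 < Im x \<or> Im x = 0 \<and> 0 < Im y" | "Im x < 0 \<or> Im x = 0 \<and> Im y < 0" by linarith
  then show "k \<in> emb ` crit_pos \<union> emb ` crit_neg \<union> upper \<union> conj ` upper"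
  proof cases
    case 1
    then have "k = emb (Re x, Re y)" by (simp add: xy emb_def complex_eq_iff)
    with k crit_real_cases emb_Z show ?thesis by blast
  next
    case 2
    then show ?thesis using k by (simp add: xy upper_def)
  next
    case 3
    then have "conj k \<in> upper" using conj_Z[OF k] by (auto simp: xy upper_def conj_def)
    then have "conj (conj k) \<in> conj ` upper" by blast
    then show ?thesis by simp
  qed
next
  fix k assume "k \<in> emb ` crit_pos \<union> emb ` crit_neg \<union> upper \<union> conj ` upper"
  then show "k \<in> Z" using emb_Z conj_Z by (auto simp: crit_pos_def crit_neg_def upper_def)
qed

text \<open>At a nonreal point the complex weight can be chosen so that z^2 J is 1 or -1 at will,
  which is why a conjugate pair counts towards both bounds. At a real point the sign is that of the
  Hessian determinant.\<close>

lemma weights_exist: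
  assumes S: "(S = crit_pos \<and> \<sigma> = 1) \<or> (S = crit_neg \<and> \<sigma> = - 1)"
  shows "\<exists>z \<epsilon>. \<forall>k\<in>emb ` S \<union> upper. 0 < \<sigma> * \<epsilon> k \<and>
      (z k)\<^sup>2 * bezoutian c k k + (cnj (z k))\<^sup>2 * bezoutian c (conj k) (conj k)
      + z k * cnj (z k) * (bezoutian c k (conj k) + bezoutian c (conj k) k) = of_real (\<epsilon> k)"
proof -
  have "\<exists>z e. 0 < \<sigma> * e \<and> z\<^sup>2 * bezoutian c k k + (cnj z)\<^sup>2 * bezoutian c (conj k) (conj k)
      + z * cnj z * (bezoutian c k (conj k) + bezoutian c (conj k) k) = of_real e"
    if k: "k \<in> emb ` S \<union> upper" for k
  proof (cases "k \<in> upper")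
    case True
    then have kZ: "k \<in> Z" "conj k \<noteq> k" by (auto simp: upper_def conj_def complex_eq_iff)
    then have "bezoutian c k (conj k) = 0" "bezoutian c (conj k) k = 0"
      using bezoutian_Z conj_Z by metis+
    moreover define J where "J = bezoutian c k k"
    have "J \<noteq> 0" using kZ simple_crit by (cases k) (auto simp: J_def Z_def bezoutian_diagonal)
    define z where "z = csqrt (of_real \<sigma> / J)"
    have "z\<^sup>2 * J = of_real \<sigma>" using \<open>J \<noteq> 0\<close> by (simp add: z_def)
    moreover from this have "(cnj z)\<^sup>2 * cnj J = of_real \<sigma>"
      by (metis complex_cnj_complex_of_real complex_cnj_mult complex_cnj_power)
    ultimately show ?thesis using S
      by (intro exI[of _ z] exI[of _ "2 * \<sigma>"]) (auto simp: bezoutian_conj J_def)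
  next
    case False
    with k obtain x y where xy: "k = emb (x, y)" "(x, y) \<in> S" by auto
    then have "conj k = k" by (simp add: emb_def conj_def)
    \<comment> \<open>The real point is listed twice with weight 1, hence its diagonal value enters
      four times.\<close>
    then show ?thesis using xy S
      by (intro exI[of _ 1] exI[of _ "4 * hessdet c x y"])
        (auto simp: bezoutian_emb crit_pos_def crit_neg_def)
  qed
  then show ?thesis by metis
qed

lemma conj_separated:
  assumes "k \<in> emb ` S \<union> upper" "l \<in> emb ` S \<union> upper" "k \<noteq> l"
  shows "conj k \<noteq> l"
proof
  assume "conj k = l"
  then show False using assms by (auto simp: upper_def conj_def emb_def complex_eq_iff)
qed

text \<open>The weight argument only treats finite sets of critical points; finiteness of the whole
  set is deduced from its bounds.\<close>

lemma finite_subsets_bound: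
  assumes "\<And>K. finite K \<Longrightarrow> K \<subseteq> S \<Longrightarrow> card K \<le> n"
  shows "finite S \<and> card S \<le> n"
proof (cases "finite S")
  case False
  then obtain K where "K \<subseteq> S" "finite K" "card K = Suc n"
    using infinite_arbitrarily_large by metis
  with assms[of K] show ?thesis by simp
qed (use assms in auto)

lemma card_pos_upper: "finite (emb ` crit_pos \<union> upper) \<and> card (emb ` crit_pos \<union> upper) \<le> 3"
proof (rule finite_subsets_bound)
  fix K assume K: "finite K" "K \<subseteq> emb ` crit_pos \<union> upper"
  obtain z \<epsilon> where w: "\<forall>k\<in>emb ` crit_pos \<union> upper. 0 < 1 * \<epsilon> k \<and>
      (z k)\<^sup>2 * bezoutian c k k + (cnj (z k))\<^sup>2 * bezoutian c (conj k) (conj k)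
      + z k * cnj (z k) * (bezoutian c k (conj k) + bezoutian c (conj k) k) = complex_of_real (\<epsilon> k)"
    using weights_exist[OF disjI1, OF conjI, OF refl refl] by (elim exE)
  have "K \<subseteq> Z" using K(2) Z_cases by blast
  then show "card K \<le> 3"
  proof (rule card_weights_le(1)[OF K(1), of z \<epsilon>])
    show "conj k \<noteq> l" if "k \<in> K" "l \<in> K" "k \<noteq> l" for k l
      using conj_separated[OF subsetD[OF K(2)] subsetD[OF K(2)]] that .
  qed (drule subsetD[OF K(2)], drule bspec[OF w], simp)+
qed

lemma card_neg_upper: "finite (emb ` crit_neg \<union> upper) \<and> card (emb ` crit_neg \<union> upper) \<le> 6"
proof (rule finite_subsets_bound)
  fix K assume K: "finite K" "K \<subseteq> emb ` crit_neg \<union> upper"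
  obtain z \<epsilon> where w: "\<forall>k\<in>emb ` crit_neg \<union> upper. 0 < - 1 * \<epsilon> k \<and>
      (z k)\<^sup>2 * bezoutian c k k + (cnj (z k))\<^sup>2 * bezoutian c (conj k) (conj k)
      + z k * cnj (z k) * (bezoutian c k (conj k) + bezoutian c (conj k) k) = complex_of_real (\<epsilon> k)"
    using weights_exist[OF disjI2, OF conjI, OF refl refl] by (elim exE)
  have "K \<subseteq> Z" using K(2) Z_cases by blast
  then show "card K \<le> 6"
  proof (rule card_weights_le(2)[OF K(1), of z \<epsilon>])
    show "conj k \<noteq> l" if "k \<in> K" "l \<in> K" "k \<noteq> l" for k l
      using conj_separated[OF subsetD[OF K(2)] subsetD[OF K(2)]] that .
  qed (drule subsetD[OF K(2)], drule bspec[OF w], simp)+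
qed

text \<open>For p positive and q negative real points and u conjugate pairs, p + u \<le> 3 and q + u
  \<le> 6 add up to p + q + 2 u \<le> 9, while there are at least 9 zeros. So both are equalities,
  and their difference does not contain u.\<close>

lemma card_crit:
  "finite crit_pos" "finite crit_neg" "card crit_pos \<le> 3" "card crit_neg = card crit_pos + 3"
proof -
  have fin: "finite (emb ` crit_pos)" "finite (emb ` crit_neg)" "finite upper"
    using card_pos_upper card_neg_upper by auto
  then show fin': "finite crit_pos" "finite crit_neg"
    using inj_emb finite_imageD inj_on_subset by blast+
  have "emb ` S \<inter> upper = {}" for S by (auto simp: emb_def upper_def)
  then have "card (emb ` S \<union> upper) = card S + card upper" if "finite S" for S
    using that fin(3) by (subst card_Un_disjoint) (auto simp: card_image inj_on_subset[OF inj_emb])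
  with card_pos_upper card_neg_upper fin' have le: "card crit_pos + card upper \<le> 3" "card crit_neg + card upper \<le> 6"
    by auto
  have "finite Z" unfolding Z_cases using fin by simp
  then have "9 \<le> card Z" by (rule card_Z_ge)
  also have "\<dots> \<le> card (emb ` crit_pos) + card (emb ` crit_neg) + card upper + card (conj ` upper)"
    unfolding Z_cases by (meson add_le_mono1 card_Un_le order_trans)
  also have "\<dots> \<le> card crit_pos + card crit_neg + card upper + card upper"
    using fin fin' by (intro add_mono card_image_le) auto
  finally show "card crit_pos \<le> 3" "card crit_neg = card crit_pos + 3" using le by linarith+
qed

lemma card_real_crits: "card (real_crits c) = 2 * card crit_pos + 3"
proof -
  have "real_crits c = crit_pos \<union> crit_neg"
    using crit_real_cases by (auto simp: real_crits_def crit_pos_def crit_neg_def)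
  moreover have "crit_pos \<inter> crit_neg = {}" by (auto simp: crit_pos_def crit_neg_def)
  ultimately show ?thesis using card_crit by (simp add: card_Un_disjoint)
qed

end

section \<open>Local maxima\<close>

lemma dX_dY: "dX (dY c) = dY (dX c)"
  by (intro ext) (simp add: dX_def dY_def)

lemma peval_second_derivatives:
  fixes x y :: "'a::{real_algebra_1, comm_ring_1}"
  shows "peval (dX (dX c)) x y = of_real (2 * c 2 0) + of_real (6 * c 3 0) * x + of_real (2 * c 2 1) * y
      + of_real (12 * c 4 0) * x^2 + of_real (6 * c 3 1) * x * y + of_real (2 * c 2 2) * y^2"
    "peval (dX (dY c)) x y = of_real (c 1 1) + of_real (2 * c 2 1) * x + of_real (2 * c 1 2) * y
      + of_real (3 * c 3 1) * x^2 + of_real (4 * c 2 2) * x * y + of_real (3 * c 1 3) * y^2"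
    "peval (dY (dY c)) x y = of_real (2 * c 0 2) + of_real (2 * c 1 2) * x + of_real (6 * c 0 3) * y
      + of_real (2 * c 2 2) * x^2 + of_real (6 * c 1 3) * x * y + of_real (12 * c 0 4) * y^2"
  by (simp_all add: peval_expand dX_def dY_def eval_nat_numeral)

lemma peval_first_derivatives:
  fixes x y :: "'a::{real_algebra_1, comm_ring_1}"
  shows "peval (dX c) x y = of_real (c 1 0) + of_real (2 * c 2 0) * x + of_real (c 1 1) * y
      + of_real (3 * c 3 0) * x^2 + of_real (2 * c 2 1) * x * y + of_real (c 1 2) * y^2
      + of_real (4 * c 4 0) * x^3 + of_real (3 * c 3 1) * x^2 * y + of_real (2 * c 2 2) * x * y^2 + of_real (c 1 3) * y^3"
    "peval (dY c) x y = of_real (c 0 1) + of_real (c 1 1) * x + of_real (2 * c 0 2) * y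
      + of_real (c 2 1) * x^2 + of_real (2 * c 1 2) * x * y + of_real (3 * c 0 3) * y^2
      + of_real (c 3 1) * x^3 + of_real (2 * c 2 2) * x^2 * y + of_real (3 * c 1 3) * x * y^2 + of_real (4 * c 0 4) * y^3"
  by (simp_all add: peval_expand dX_def dY_def eval_nat_numeral)

text \<open>Taylor's formula with the terms of order at least two written as a quadratic form in
  \<open>(h, k)\<close> whose outer coefficients depend continuously on \<open>(h, k)\<close>.\<close>

lemma peval_taylor:
  fixes x y :: real
  obtains u w :: "real \<times> real \<Rightarrow> real" where
    "\<And>h k. peval c (x + h) (y + k) = peval c x y + h * peval (dX c) x y + k * peval (dY c) x y
      + (h\<^sup>2 * u (h, k) + h * k * peval (dX (dY c)) x y + k\<^sup>2 * w (h, k))"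
    "isCont u (0, 0)" "isCont w (0, 0)"
    "u (0, 0) = peval (dX (dX c)) x y / 2" "w (0, 0) = peval (dY (dY c)) x y / 2"
proof
  let ?u = "\<lambda>p :: real \<times> real. c 2 0 + 3 * c 3 0 * x + c 2 1 * y + 6 * c 4 0 * x\<^sup>2 + 3 * c 3 1 * x * y + c 2 2 * y\<^sup>2
      + (c 3 0 + 4 * c 4 0 * x + c 3 1 * y) * fst p
      + (c 2 1 + 3 * c 3 1 * x + 2 * c 2 2 * y) * snd p
      + c 4 0 * (fst p)\<^sup>2 + c 3 1 * fst p * snd p + c 2 2 * (snd p)\<^sup>2"
  let ?w = "\<lambda>p :: real \<times> real. c 0 2 + c 1 2 * x + 3 * c 0 3 * y + c 2 2 * x\<^sup>2 + 3 * c 1 3 * x * y + 6 * c 0 4 * y\<^sup>2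
      + (c 1 2 + 2 * c 2 2 * x + 3 * c 1 3 * y) * fst p
      + (c 0 3 + 4 * c 0 4 * y + c 1 3 * x) * snd p
      + c 1 3 * fst p * snd p + c 0 4 * (snd p)\<^sup>2"
  show "peval c (x + h) (y + k) = peval c x y + h * peval (dX c) x y + k * peval (dY c) x y
      + (h\<^sup>2 * ?u (h, k) + h * k * peval (dX (dY c)) x y + k\<^sup>2 * ?w (h, k))" for h k
    unfolding peval_second_derivatives unfolding peval_first_derivatives
    unfolding peval_expand of_real_eq_id id_apply fst_conv snd_conv by algebra
  show "isCont ?u (0, 0)" "isCont ?w (0, 0)"
    by (intro continuous_intros)+
qed (simp_all add: peval_second_derivatives)

text \<open>Dividing by t on either side of 0 bounds \<open>G\<close> from both sides; once G = 0,
  dividing by t^2 gives the sign of \<open>R 0\<close>.\<close>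

lemma local_max_expansion:
  fixes R :: "real \<Rightarrow> real"
  assumes "isCont R 0" "0 < e" and le: "\<And>t. \<bar>t\<bar> < e \<Longrightarrow> t * G + t\<^sup>2 * R t \<le> 0"
  shows "G = 0" "R 0 \<le> 0"
proof -
  have R: "(R \<longlongrightarrow> R 0) (at 0)" using assms(1) by (simp add: isCont_def)
  then have lim: "((\<lambda>t. G + t * R t) \<longlongrightarrow> G) (at 0)"
    using tendsto_add[OF tendsto_const tendsto_mult[OF tendsto_ident_at]] by fastforce
  have near: "eventually (\<lambda>t. \<bar>t\<bar> < e \<and> t \<noteq> 0) (at (0::real))"
    using \<open>0 < e\<close> by (auto simp: eventually_at dist_real_def intro!: exI[of _ e])
  have le': "t * (G + t * R t) \<le> 0" if "\<bar>t\<bar> < e" for t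
    using le[OF that] by (simp add: algebra_simps power2_eq_square)
  have "G \<le> 0"
  proof (rule tendsto_upperbound)
    show "((\<lambda>t. G + t * R t) \<longlongrightarrow> G) (at_right 0)"
      by (rule tendsto_mono[OF at_le lim]) simp
    have "eventually (\<lambda>t. \<bar>t\<bar> < e \<and> 0 < t) (at_right (0::real))"
      using \<open>0 < e\<close> by (auto simp: eventually_at dist_real_def intro!: exI[of _ e])
    then show "eventually (\<lambda>t. G + t * R t \<le> 0) (at_right 0)"
    proof (rule eventually_mono)
      fix t assume "\<bar>t\<bar> < e \<and> 0 < t"
      then show "G + t * R t \<le> 0" using le'[of t] by (auto simp: mult_le_0_iff)
    qed
  qed simp
  moreover have "0 \<le> G"
  proof (rule tendsto_lowerbound)
    show "((\<lambda>t. G + t * R t) \<longlongrightarrow> G) (at_left 0)"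
      by (rule tendsto_mono[OF at_le lim]) simp
    have "eventually (\<lambda>t. \<bar>t\<bar> < e \<and> t < 0) (at_left (0::real))"
      using \<open>0 < e\<close> by (auto simp: eventually_at dist_real_def intro!: exI[of _ e])
    then show "eventually (\<lambda>t. 0 \<le> G + t * R t) (at_left 0)"
    proof (rule eventually_mono)
      fix t assume "\<bar>t\<bar> < e \<and> t < 0"
      then show "0 \<le> G + t * R t" using le'[of t] by (auto simp: mult_le_0_iff)
    qed
  qed simp
  ultimately show "G = 0" by simp
  show "R 0 \<le> 0"
  proof (rule tendsto_upperbound[OF R])
    show "eventually (\<lambda>t. R t \<le> 0) (at 0)"
      using near by (rule eventually_mono) (use le \<open>G = 0\<close> in \<open>auto simp: mult_le_0_iff\<close>)
  qed simp
qed

lemma local_maximaD: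
  assumes "(x, y) \<in> local_maxima c"
  shows "crit c x y"
    "h\<^sup>2 * peval (dX (dX c)) x y + 2 * h * k * peval (dX (dY c)) x y + k\<^sup>2 * peval (dY (dY c)) x y \<le> 0"
proof -
  obtain e where e: "0 < e" "\<And>w. dist w (x, y) < e \<Longrightarrow> peval c (fst w) (snd w) \<le> peval c x y"
    using assms by (auto simp: local_maxima_def)
  obtain u w where tay: "\<And>h k. peval c (x + h) (y + k) = peval c x y + h * peval (dX c) x y + k * peval (dY c) x y
      + (h\<^sup>2 * u (h, k) + h * k * peval (dX (dY c)) x y + k\<^sup>2 * w (h, k))"
    "isCont u (0, 0)" "isCont w (0, 0)"
    "u (0, 0) = peval (dX (dX c)) x y / 2" "w (0, 0) = peval (dY (dY c)) x y / 2"
    by (rule peval_taylor[of c x y]) blast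
  have *: "h * peval (dX c) x y + k * peval (dY c) x y = 0 \<and>
      h\<^sup>2 * u (0, 0) + h * k * peval (dX (dY c)) x y + k\<^sup>2 * w (0, 0) \<le> 0" for h k
  proof -
    define R where "R t = h\<^sup>2 * u (t * h, t * k) + h * k * peval (dX (dY c)) x y + k\<^sup>2 * w (t * h, t * k)" for t
    have "isCont (\<lambda>t. v (t * h, t * k)) 0" if "isCont v (0, 0)" for v :: "real \<times> real \<Rightarrow> real"
    proof (rule isCont_o2[where g = v and f = "\<lambda>t. (t * h, t * k)"])
      show "isCont (\<lambda>t. (t * h, t * k)) 0" by (intro continuous_intros)
    qed (use that in simp)
    then have "isCont R 0" unfolding R_def[abs_def] using tay(2,3) by (intro continuous_intros)
    \<comment> \<open>The summand 1 keeps the quotient meaningful for h = k = 0.\<close>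
    moreover define d where "d = e / (norm (h, k) + 1)"
    have "0 < d" using e(1) by (simp add: d_def add_nonneg_pos)
    moreover have "t * (h * peval (dX c) x y + k * peval (dY c) x y) + t\<^sup>2 * R t \<le> 0" if "\<bar>t\<bar> < d" for t
    proof -
      have "dist (x + t * h, y + t * k) (x, y) = norm (t *\<^sub>R (h, k))" by (simp add: dist_norm)
      also have "\<dots> = \<bar>t\<bar> * norm (h, k)" by (rule norm_scaleR)
      also have "\<dots> \<le> \<bar>t\<bar> * (norm (h, k) + 1)" by (simp add: mult_left_mono)
      also have "\<dots> < d * (norm (h, k) + 1)" using that by (intro mult_strict_right_mono) (simp_all add: add_nonneg_pos)
      also have "\<dots> = e" by (simp add: d_def add_nonneg_eq_0_iff)
      finally have "peval c (x + t * h) (y + t * k) \<le> peval c x y" using e(2)[of "(x + t * h, y + t * k)"] by simp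
      then show ?thesis unfolding tay(1) R_def by (simp add: algebra_simps power2_eq_square)
    qed
    ultimately have "h * peval (dX c) x y + k * peval (dY c) x y = 0" "R 0 \<le> 0"
      using local_max_expansion by blast+
    then show ?thesis by (simp add: R_def)
  qed
  show "crit c x y" using *[of 1 0] *[of 0 1] by (simp add: crit_def)
  show "h\<^sup>2 * peval (dX (dX c)) x y + 2 * h * k * peval (dX (dY c)) x y + k\<^sup>2 * peval (dY (dY c)) x y \<le> 0"
    using *[of h k] by (simp add: tay(4,5) algebra_simps)
qed

text \<open>The exact remainder is a quadratic form with continuous coefficients, so its
  definiteness persists for small (h, k); completing the square then gives the sign.\<close>

lemma local_maximaI:
  assumes "crit c x y" "0 < hessdet c x y" "peval (dX (dX c)) x y < 0"
  shows "(x, y) \<in> local_maxima c"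
proof -
  obtain u w where tay: "\<And>h k. peval c (x + h) (y + k) = peval c x y + h * peval (dX c) x y + k * peval (dY c) x y
      + (h\<^sup>2 * u (h, k) + h * k * peval (dX (dY c)) x y + k\<^sup>2 * w (h, k))"
    "isCont u (0, 0)" "isCont w (0, 0)"
    "u (0, 0) = peval (dX (dX c)) x y / 2" "w (0, 0) = peval (dY (dY c)) x y / 2"
    by (rule peval_taylor[of c x y]) blast
  define v where "v = peval (dX (dY c)) x y"
  have nhds: "(f \<longlongrightarrow> f (0, 0)) (nhds (0, 0))" if "isCont f (0, 0)" for f :: "real \<times> real \<Rightarrow> real"
    using that by (simp only: isCont_def tendsto_at_iff_tendsto_nhds)
  have "((\<lambda>p. 4 * u p * w p - v\<^sup>2) \<longlongrightarrow> 4 * u (0, 0) * w (0, 0) - v\<^sup>2) (nhds (0, 0))"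
    by (intro tendsto_intros nhds tay(2,3))
  moreover have "0 < 4 * u (0, 0) * w (0, 0) - v\<^sup>2"
    using assms(2) by (simp add: hessdet_def tay(4,5) v_def dX_dY power2_eq_square)
  ultimately have "eventually (\<lambda>p. 0 < 4 * u p * w p - v\<^sup>2) (nhds (0, 0))"
    by (rule order_tendstoD(1))
  moreover have "eventually (\<lambda>p. u p < 0) (nhds (0, 0))"
    by (rule order_tendstoD(2)[OF nhds[OF tay(2)]]) (use tay(4) assms(3) in simp)
  ultimately have "eventually (\<lambda>p. 0 < 4 * u p * w p - v\<^sup>2 \<and> u p < 0) (nhds (0, 0))"
    by (rule eventually_conj)
  then obtain e where e: "0 < e" "\<And>p. dist p (0, 0) < e \<Longrightarrow> 0 < 4 * u p * w p - v\<^sup>2 \<and> u p < 0"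
    unfolding eventually_nhds_metric by blast
  have "peval c (fst p) (snd p) \<le> peval c x y" if p: "dist p (x, y) < e" for p
  proof -
    obtain h k where hk: "p = (x + h, y + k)"
      by (metis add.commute diff_add_cancel prod.exhaust)
    have "dist (h, k) (0, 0) < e" using p by (simp add: hk dist_norm)
    then have uw: "0 < 4 * u (h, k) * w (h, k) - v\<^sup>2" "u (h, k) < 0" using e(2) by blast+
    have "4 * u (h, k) * (h\<^sup>2 * u (h, k) + h * k * v + k\<^sup>2 * w (h, k))
        = (2 * u (h, k) * h + v * k)\<^sup>2 + (4 * u (h, k) * w (h, k) - v\<^sup>2) * k\<^sup>2"
      by (simp add: algebra_simps power2_eq_square)
    also have "\<dots> \<ge> 0" using uw by simp
    finally have "h\<^sup>2 * u (h, k) + h * k * v + k\<^sup>2 * w (h, k) \<le> 0"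
      using uw(2) by (simp add: zero_le_mult_iff)
    then show ?thesis using assms(1) tay(1)[of h k] by (simp add: hk crit_def v_def)
  qed
  then show ?thesis using e(1) by (auto simp: local_maxima_def)
qed

section \<open>Examples\<close>

text \<open>Semidefiniteness is necessary and definiteness sufficient; a nonzero determinant closes
  the gap.\<close>

lemma local_maxima_iff:
  assumes "\<And>x y :: real. crit c x y \<Longrightarrow> hessdet c x y \<noteq> 0"
  shows "(x, y) \<in> local_maxima c \<longleftrightarrow> crit c x y \<and> 0 < hessdet c x y \<and> peval (dX (dX c)) x y < 0"
proof
  assume max: "(x, y) \<in> local_maxima c"
  define A B C where "A = peval (dX (dX c)) x y" and "B = peval (dX (dY c)) x y" and "C = peval (dY (dY c)) x y"
  have le: "h\<^sup>2 * A + 2 * h * k * B + k\<^sup>2 * C \<le> 0" for h k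
    using local_maximaD(2)[OF max] by (simp add: A_def B_def C_def)
  have crit: "crit c x y" using max by (rule local_maximaD(1))
  have hess: "hessdet c x y = A * C - B\<^sup>2"
    by (simp add: hessdet_def A_def B_def C_def dX_dY power2_eq_square)
  have "A \<le> 0" "C \<le> 0" using le[of 1 0] le[of 0 1] by simp_all
  have nz: "A * C - B\<^sup>2 \<noteq> 0" using assms[OF crit] hess by simp
  \<comment> \<open>The test vectors (B, -A) and (C, -B) turn the form into A and C times the
    determinant.\<close>
  have "A * (A * C - B\<^sup>2) \<le> 0" "C * (A * C - B\<^sup>2) \<le> 0"
    using le[of B "- A"] le[of C "- B"] by (simp_all add: algebra_simps power2_eq_square)
  have "0 < A * C - B\<^sup>2 \<and> A < 0"
  proof (cases "A = 0 \<and> C = 0")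
    case True
    with le[of 1 1] le[of 1 "- 1"] have "B = 0" by simp
    with True nz show ?thesis by simp
  next
    case False
    with \<open>A \<le> 0\<close> \<open>C \<le> 0\<close> have "A < 0 \<or> C < 0" by auto
    then have "0 \<le> A * C - B\<^sup>2"
      using \<open>A * (A * C - B\<^sup>2) \<le> 0\<close> \<open>C * (A * C - B\<^sup>2) \<le> 0\<close> by (auto simp: mult_le_0_iff)
    with nz have "0 < A * C - B\<^sup>2" by simp
    moreover from this have "A \<noteq> 0" by auto
    ultimately show ?thesis using \<open>A \<le> 0\<close> by simp
  qed
  then show "crit c x y \<and> 0 < hessdet c x y \<and> peval (dX (dX c)) x y < 0"
    using crit hess A_def by simp
qed (use local_maximaI in blast)

section \<open>The symmetry exchanging maxima and minima\<close>

lemma uminus_coeffs: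
  fixes x y :: "'a::{real_algebra_1, comm_ring_1}"
  shows "peval (\<lambda>i j. - c i j) x y = - peval c x y" "top4 (\<lambda>i j. - c i j) x y = - top4 c x y"
    "dX (\<lambda>i j. - c i j) = (\<lambda>i j. - dX c i j)" "dY (\<lambda>i j. - c i j) = (\<lambda>i j. - dY c i j)"
  by (simp_all add: peval_def top4_def sum_negf dX_def dY_def fun_eq_iff)

lemma crit_uminus [simp]: "crit (\<lambda>i j. - c i j) x y \<longleftrightarrow> crit c x y"
  for x y :: "'a::{real_algebra_1, comm_ring_1}"
  by (simp add: crit_def uminus_coeffs)

lemma hessdet_uminus [simp]: "hessdet (\<lambda>i j. - c i j) x y = hessdet c x y"
  by (simp add: hessdet_def uminus_coeffs)

lemma morse4_uminus:
  assumes "morse4 c"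
  shows "morse4 (\<lambda>i j. - c i j)"
proof -
  obtain a b :: "nat \<Rightarrow> complex" where ab: "\<forall>x y. top4 c x y = (\<Prod>k<4. a k * x + b k * y)"
    "\<forall>k<4. \<forall>l<4. k \<noteq> l \<longrightarrow> a k * b l \<noteq> a l * b k"
    using assms unfolding morse4_def nondegenerate4_def by (elim exE conjE)
  have "nondegenerate4 (\<lambda>i j. - c i j)"
    unfolding nondegenerate4_def
  proof (rule exI[of _ "a(0 := - a 0)"], rule exI[of _ "b(0 := - b 0)"], rule conjI)
    show "\<forall>x y. top4 (\<lambda>i j. - c i j) x y = (\<Prod>k<4. (a(0 := - a 0)) k * x + (b(0 := - b 0)) k * y)"
      unfolding uminus_coeffs ab(1)[rule_format] by (simp add: eval_nat_numeral algebra_simps)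
  qed (use ab(2) in auto)
  then show ?thesis using assms by (simp add: morse4_def)
qed

lemma four_real_lines_uminus: "four_real_lines c \<Longrightarrow> four_real_lines (\<lambda>i j. - c i j)"
  by (simp add: four_real_lines_def uminus_coeffs)

lemma morse_hyperbolic:
  assumes "morse4 c" "four_real_lines c"
  obtains a b where "hyperbolic_morse c a b"
proof -
  obtain a b :: "nat \<Rightarrow> real" where ab: "\<And>x y :: real. top4 c x y = (\<Prod>k<4. a k * x + b k * y)"
    "\<And>k l. k < 4 \<Longrightarrow> l < 4 \<Longrightarrow> k \<noteq> l \<Longrightarrow> a k * b l \<noteq> a l * b k"
    by (rule four_real_lines_product[OF _ assms(2)]) (use assms(1) in \<open>auto simp: morse4_def\<close>)
  have "hyperbolic_morse c a b"
    using assms(1) ab by unfold_locales (auto simp: morse4_def)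
  then show ?thesis by (rule that)
qed

context hyperbolic_morse
begin

lemma real_simple_crit: "crit c x y \<Longrightarrow> hessdet c x y \<noteq> 0" for x y :: real
  using crit_real_cases by (force simp: crit_pos_def crit_neg_def)

lemma local_maxima_eq: "local_maxima c = {(x, y) \<in> crit_pos. peval (dX (dX c)) x y < 0}"
  using local_maxima_iff[OF real_simple_crit] by (auto simp: crit_pos_def)

lemma card_local_maxima_le: "card (local_maxima c) \<le> card crit_pos"
  unfolding local_maxima_eq by (rule card_mono) (use card_crit in auto)

text \<open>A positive Hessian determinant forces a nonzero second derivative in x, whose sign
  separates maxima from minima.\<close>

lemma card_local_extrema: "card (local_maxima c) + card (local_maxima (\<lambda>i j. - c i j)) = card crit_pos"
proof -
  let ?N = "{(x, y) \<in> crit_pos. 0 < peval (dX (dX c)) x y}"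
  have N: "local_maxima (\<lambda>i j. - c i j) = ?N"
    using local_maxima_iff[of "\<lambda>i j. - c i j"] real_simple_crit
    by (auto simp: crit_pos_def uminus_coeffs)
  have "peval (dX (dX c)) x y \<noteq> 0" if "(x, y) \<in> crit_pos" for x y
  proof
    assume "peval (dX (dX c)) x y = 0"
    then have "hessdet c x y = - (peval (dX (dY c)) x y)\<^sup>2"
      by (simp add: hessdet_def dX_dY power2_eq_square)
    with that show False by (simp add: crit_pos_def)
  qed
  then have un: "local_maxima c \<union> ?N = crit_pos" unfolding local_maxima_eq by force
  have "local_maxima c \<inter> ?N = {}" unfolding local_maxima_eq by force
  moreover have "finite (local_maxima c)" "finite ?N"
    by (rule finite_subset[OF _ card_crit(1)], use un in blast)+
  ultimately have "card (local_maxima c \<union> ?N) = card (local_maxima c) + card ?N"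
    by (intro card_Un_disjoint)
  then show ?thesis unfolding N un by simp
qed

end

section \<open>Pairs of counts and the quartics that realise them\<close>

definition realized :: "nat \<Rightarrow> nat \<Rightarrow> bool" where
  "realized M m \<longleftrightarrow> (\<exists>c. morse4 c \<and> four_real_lines c \<and> card (real_crits c) = M \<and> card (local_maxima c) = m)"

lemma realized_bounds:
  assumes "realized M m"
  shows "\<exists>n\<le>3. M = 2 * n + 3 \<and> m \<le> n"
proof -
  obtain c where c: "morse4 c" "four_real_lines c" "card (real_crits c) = M" "card (local_maxima c) = m"
    using assms by (auto simp: realized_def)
  then obtain a b where "hyperbolic_morse c a b" by (elim morse_hyperbolic)
  then interpret hyperbolic_morse c a b .
  show ?thesis using card_real_crits card_crit(3) card_local_maxima_le c(3,4)
    by (intro exI[of _ "card crit_pos"]) auto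
qed

lemma realized_uminus:
  assumes "realized (2 * n + 3) m"
  shows "realized (2 * n + 3) (n - m)"
proof -
  obtain c where c: "morse4 c" "four_real_lines c" "card (real_crits c) = 2 * n + 3" "card (local_maxima c) = m"
    using assms by (auto simp: realized_def)
  then obtain a b where "hyperbolic_morse c a b" by (elim morse_hyperbolic)
  then interpret hyperbolic_morse c a b .
  have "card (local_maxima (\<lambda>i j. - c i j)) = n - m"
    using card_local_extrema card_real_crits c(3,4) by simp
  moreover have "real_crits (\<lambda>i j. - c i j) = real_crits c" by (simp add: real_crits_def)
  ultimately show ?thesis using c morse4_uminus four_real_lines_uminus unfolding realized_def by metis
qed

text \<open>The family \<open>(y\<^sup>2 - (x\<^sup>2 - w))\<^sup>2 + G x\<close> with \<open>A x = (x\<^sup>2 - w)\<^sup>2 + G x\<close>: its critical points lie over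
  the roots of \<open>A'\<close> on the axis \<open>y = 0\<close> and over the roots of \<open>G'\<close> on \<open>y\<^sup>2 = x\<^sup>2 - w\<close>. The side
  conditions say that \<open>A' - G' = ((x\<^sup>2 - w)\<^sup>2)'\<close>, where \<open>A'\<close> and \<open>- G'\<close> have leading
  coefficients \<open>4 \<alpha>\<close> and \<open>4 (1 - \<alpha>)\<close>.\<close>

locale symmetric_quartic =
  fixes \<alpha> w a1 a2 a3 g1 g2 g3 :: real
  assumes \<alpha>: "0 < \<alpha>" "\<alpha> < 1"
    and e1: "\<alpha> * (a1 + a2 + a3) + (1 - \<alpha>) * (g1 + g2 + g3) = 0"
    and e2: "\<alpha> * (a1 * a2 + a1 * a3 + a2 * a3) + (1 - \<alpha>) * (g1 * g2 + g1 * g3 + g2 * g3) = - w"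
    and e3: "\<alpha> * (a1 * a2 * a3) + (1 - \<alpha>) * (g1 * g2 * g3) = 0"
    and ordered: "a1 < a2" "a2 < a3" "g1 < g2" "g2 < g3"
    and generic: "a1\<^sup>2 \<noteq> w" "a2\<^sup>2 \<noteq> w" "a3\<^sup>2 \<noteq> w" "g1\<^sup>2 \<noteq> w" "g2\<^sup>2 \<noteq> w" "g3\<^sup>2 \<noteq> w"
begin

text \<open>The coefficients of y^4 - 2 (x^2 - w) y^2 + A x, where \<open>A\<close> is the
  antiderivative of 4 \<alpha> (x - a1) (x - a2) (x - a3) without constant term.\<close>

definition c :: "nat \<Rightarrow> nat \<Rightarrow> real" where
  "c i j = (if (i, j) = (4, 0) then \<alpha> else if (i, j) = (2, 2) then - 2 else if (i, j) = (0, 4) then 1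
     else if (i, j) = (3, 0) then - (4 / 3) * \<alpha> * (a1 + a2 + a3)
     else if (i, j) = (2, 0) then 2 * \<alpha> * (a1 * a2 + a1 * a3 + a2 * a3)
     else if (i, j) = (1, 0) then - 4 * \<alpha> * (a1 * a2 * a3)
     else if (i, j) = (0, 2) then 2 * w else 0)"

lemma derivatives:
  fixes x y :: "'a::real_field"
  shows "peval (dX c) x y = of_real (4 * \<alpha>) * ((x - of_real a1) * (x - of_real a2) * (x - of_real a3)) - 4 * x * y^2"
    "peval (dY c) x y = 4 * y * (y^2 - x^2 + of_real w)"
    "peval (dX (dX c)) x y = of_real (4 * \<alpha>) * ((x - of_real a1) * (x - of_real a2)
      + (x - of_real a1) * (x - of_real a3) + (x - of_real a2) * (x - of_real a3)) - 4 * y^2"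
    "peval (dX (dY c)) x y = - 8 * x * y"
    "peval (dY (dY c)) x y = 12 * y^2 - 4 * x^2 + of_real (4 * w)"
  unfolding peval_second_derivatives
  by (simp_all add: peval_first_derivatives c_def field_simps power2_eq_square power3_eq_cube)

text \<open>On this curve the x-derivative is A' - 4 x (x^2 - w), which the side conditions identify
  with G'.\<close>

lemma off_axis_cubic:
  fixes x y :: "'a::real_field"
  assumes "y^2 = x^2 - of_real w"
  shows "peval (dX c) x y = - of_real (4 * (1 - \<alpha>)) * ((x - of_real g1) * (x - of_real g2) * (x - of_real g3))"
proof -
  have "of_real (\<alpha> * (a1 + a2 + a3) + (1 - \<alpha>) * (g1 + g2 + g3)) = (0::'a)"
    "of_real (\<alpha> * (a1 * a2 + a1 * a3 + a2 * a3) + (1 - \<alpha>) * (g1 * g2 + g1 * g3 + g2 * g3)) = (- of_real w::'a)"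
    "of_real (\<alpha> * (a1 * a2 * a3) + (1 - \<alpha>) * (g1 * g2 * g3)) = (0::'a)"
    unfolding e1 e2 e3 by simp_all
  then show ?thesis unfolding derivatives assms of_real_add of_real_mult of_real_diff of_real_1 of_real_numeral
    by algebra
qed

lemma crit_cases:
  fixes x y :: "'a::real_field"
  shows "crit c x y \<longleftrightarrow> y = 0 \<and> x \<in> {of_real a1, of_real a2, of_real a3}
    \<or> y^2 = x^2 - of_real w \<and> x \<in> {of_real g1, of_real g2, of_real g3}"
proof -
  have "crit c x y \<longleftrightarrow> peval (dX c) x y = 0 \<and> (y = 0 \<or> y^2 = x^2 - of_real w)"
  proof -
    have "y\<^sup>2 - x\<^sup>2 + of_real w = 0 \<longleftrightarrow> y\<^sup>2 = x\<^sup>2 - of_real w" by (auto simp: algebra_simps)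
    then show ?thesis unfolding crit_def derivatives(2) by simp
  qed
  also have "\<dots> \<longleftrightarrow> y = 0 \<and> peval (dX c) x 0 = 0 \<or> y^2 = x^2 - of_real w \<and> peval (dX c) x y = 0" by auto
  also have "\<dots> \<longleftrightarrow> y = 0 \<and> x \<in> {of_real a1, of_real a2, of_real a3}
    \<or> y^2 = x^2 - of_real w \<and> x \<in> {of_real g1, of_real g2, of_real g3}"
  proof -
    have "peval (dX c) x 0 = 0 \<longleftrightarrow> x \<in> {of_real a1, of_real a2, of_real a3}"
      using \<alpha> by (auto simp: derivatives(1))
    moreover have "peval (dX c) x y = 0 \<longleftrightarrow> x \<in> {of_real g1, of_real g2, of_real g3}"
      if "y^2 = x^2 - of_real w"
      unfolding off_axis_cubic[OF that] using \<alpha> by (auto simp del: of_real_diff of_real_mult)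
    ultimately show ?thesis by blast
  qed
  finally show ?thesis .
qed

lemma hessdet_axis:
  "hessdet c x 0 = of_real (- 16 * \<alpha>) * ((x - of_real a1) * (x - of_real a2)
      + (x - of_real a1) * (x - of_real a3) + (x - of_real a2) * (x - of_real a3)) * (x^2 - of_real w)"
  for x :: "'a::real_field"
  by (simp add: hessdet_def derivatives dX_dY[symmetric] algebra_simps)

text \<open>Here the second y-derivative is 8 y^2 and the mixed one is - 8 x y, so the determinant
  becomes 8 y^2 G''.\<close>

lemma hessdet_off_axis:
  fixes x y :: "'a::real_field"
  assumes "y^2 = x^2 - of_real w"
  shows "hessdet c x y = - of_real (32 * (1 - \<alpha>)) * (x^2 - of_real w) *
    ((x - of_real g1) * (x - of_real g2) + (x - of_real g1) * (x - of_real g3) + (x - of_real g2) * (x - of_real g3))"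
proof -
  have e: "of_real (\<alpha> * (a1 + a2 + a3) + (1 - \<alpha>) * (g1 + g2 + g3)) = (0::'a)"
    "of_real (\<alpha> * (a1 * a2 + a1 * a3 + a2 * a3) + (1 - \<alpha>) * (g1 * g2 + g1 * g3 + g2 * g3)) = (- of_real w::'a)"
    unfolding e1 e2 by simp_all
  have "(- 8 * x * y) * (- 8 * x * y) = 64 * x^2 * y^2" by (simp add: power2_eq_square algebra_simps)
  then show ?thesis
    using e unfolding hessdet_def dX_dY[symmetric] derivatives assms of_real_add of_real_mult of_real_diff of_real_1 of_real_numeral of_real_minus
    by algebra
qed

lemma critical_points_simple:
  fixes x y :: "'a::real_field"
  assumes "crit c x y"
  shows "hessdet c x y \<noteq> 0"
proof -
  have w: "(of_real t)\<^sup>2 - of_real w \<noteq> (0::'a)" if "t\<^sup>2 \<noteq> w" for t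
    using that by (simp flip: of_real_power)
  consider "y = 0" "x \<in> {of_real a1, of_real a2, of_real a3}"
    | "y^2 = x^2 - of_real w" "x \<in> {of_real g1, of_real g2, of_real g3}"
    using assms crit_cases by blast
  then show ?thesis
  proof cases
    case 1
    then show ?thesis using ordered \<alpha> w[OF generic(1)] w[OF generic(2)] w[OF generic(3)]
      by (auto simp: hessdet_axis)
  next
    case 2
    then show ?thesis using ordered \<alpha> w[OF generic(4)] w[OF generic(5)] w[OF generic(6)]
      unfolding hessdet_off_axis[OF 2(1)] by auto
  qed
qed

text \<open>The form \<alpha> x^4 - 2 x^2 y^2 + y^4 vanishes when y^2 / x^2 is 1 + s or 1 - s with s
  = sqrt (1 - \<alpha>), two distinct positive values because 0 < \<alpha> < 1.\<close>

lemma lines: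
  obtains t :: "nat \<Rightarrow> real" where "inj_on t {..<4}"
    "\<And>x y :: 'a::real_field. top4 c x y = (\<Prod>k<4. of_real (t k) * x + 1 * y)"
proof -
  define s where "s = sqrt (1 - \<alpha>)"
  have s: "0 < s" "s < 1" "s\<^sup>2 = 1 - \<alpha>" using \<alpha> by (simp_all add: s_def)
  define p q where "p = sqrt (1 + s)" and "q = sqrt (1 - s)"
  have pq: "p\<^sup>2 = 1 + s" "q\<^sup>2 = 1 - s" "0 < q" "q < p" using s by (simp_all add: p_def q_def)
  define t where "t k = [p, - p, q, - q] ! k" for k
  have "inj_on t {..<4}"
    using pq by (auto simp: inj_on_def t_def eval_nat_numeral less_Suc_eq)
  moreover have "top4 c x y = (\<Prod>k<4. of_real (t k) * x + 1 * y)" for x y :: 'a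
  proof -
    have "p\<^sup>2 + q\<^sup>2 = 2" "p\<^sup>2 * q\<^sup>2 = \<alpha>"
      unfolding pq(1,2) using s(3) by (simp_all add: algebra_simps power2_eq_square)
    then have "of_real p ^ 2 + of_real q ^ 2 = (2::'a)" "of_real p ^ 2 * of_real q ^ 2 = (of_real \<alpha>::'a)"
      by (metis of_real_add of_real_power of_real_numeral, metis of_real_mult of_real_power)
    moreover have "(\<Prod>k<4. of_real (t k) * x + 1 * y) =
        (of_real p * x + y) * (- of_real p * x + y) * (of_real q * x + y) * (- of_real q * x + y)"
      by (simp add: t_def eval_nat_numeral mult.assoc)
    moreover have "\<dots> = (of_real p ^ 2 * of_real q ^ 2) * x^4 - (of_real p ^ 2 + of_real q ^ 2) * x^2 * y^2 + y^4"
      by (simp add: algebra_simps power2_eq_square power4_eq_xxxx)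
    moreover have "top4 c x y = of_real \<alpha> * x^4 - 2 * x^2 * y^2 + y^4"
      by (simp add: top4_expand c_def)
    ultimately show ?thesis by simp
  qed
  ultimately show ?thesis by (rule that)
qed

lemma morse: "morse4 c"
proof -
  obtain t :: "nat \<Rightarrow> real" where t: "inj_on t {..<4}" "\<And>x y :: complex. top4 c x y = (\<Prod>k<4. of_real (t k) * x + 1 * y)"
    by (rule lines) blast
  have "nondegenerate4 c"
    unfolding nondegenerate4_def using t
    by (intro exI[of _ "\<lambda>k. of_real (t k)"] exI[of _ "\<lambda>_. 1"]) (auto simp: inj_on_def)
  then show ?thesis using critical_points_simple[where ?'a = complex] by (simp add: morse4_def)
qed

lemma four_lines: "four_real_lines c"
proof -
  obtain t :: "nat \<Rightarrow> real" where t: "inj_on t {..<4}" "\<And>x y :: real. top4 c x y = (\<Prod>k<4. of_real (t k) * x + 1 * y)"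
    by (rule lines) blast
  show ?thesis unfolding four_real_lines_def
  proof (rule exI[of _ t], rule exI[of _ "\<lambda>_. 1"], rule exI[of _ "\<lambda>_. 0"], intro conjI allI impI)
    fix k l :: nat assume kl: "k < 4" "l < 4" "k \<noteq> l"
    then have "t k \<noteq> t l" using t(1) by (auto simp: inj_on_def)
    moreover have "(1, - t k) \<in> {(x, y). t k * x + 1 * y = 0}" by simp
    moreover have "(1, - t k) \<in> {(x, y). t l * x + 1 * y = 0} \<longleftrightarrow> t k = t l" by auto
    ultimately show "{(x, y). t k * x + 1 * y = 0} \<noteq> {(x, y). t l * x + 1 * y = 0}" by metis
  next
    fix k :: nat and x y :: real assume "k < 4" "t k * x + 1 * y = 0"
    then show "top4 c x y = 0" unfolding t(2) by (intro prod_zero bexI[of _ k]) simp_all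
  qed simp
qed

text \<open>On the axis A' decreases only through its middle root \<open>a2\<close>, where the
  second y-derivative - 4 (a2^2 - w) must be negative too. Off the axis the second y-derivative is 8
  y^2, which rules out a maximum.\<close>

lemma local_maxima: "local_maxima c = (if w < a2\<^sup>2 then {(a2, 0)} else {})"
proof -
  have "(x, y) \<in> local_maxima c \<longleftrightarrow> w < a2\<^sup>2 \<and> x = a2 \<and> y = 0" for x y
  proof (cases "y = 0 \<and> x \<in> {a1, a2, a3}")
    case True
    have \<open>(x, y) \<in> local_maxima c \<longleftrightarrow> 0 < hessdet c x 0 \<and> peval (dX (dX c)) x 0 < 0\<close>
      using local_maxima_iff[of c x y, OF critical_points_simple] crit_cases[of x y] True by auto
    also have "\<dots> \<longleftrightarrow> peval (dX (dX c)) x 0 < 0 \<and> w < x\<^sup>2"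
      unfolding hessdet_axis derivatives by (auto simp: zero_less_mult_iff mult_less_0_iff)
    also have "\<dots> \<longleftrightarrow> w < a2\<^sup>2 \<and> x = a2 \<and> y = 0"
      using True ordered \<alpha> unfolding derivatives by (auto simp: zero_less_mult_iff mult_less_0_iff)
    finally show ?thesis .
  next
    case False
    have "\<not> (0 < hessdet c x y \<and> peval (dX (dX c)) x y < 0)" if "crit c x y"
    proof
      assume *: "0 < hessdet c x y \<and> peval (dX (dX c)) x y < 0"
      have "peval (dY (dY c)) x y = 8 * y\<^sup>2"
        using that False by (auto simp: crit_cases derivatives)
      then have "peval (dX (dX c)) x y * peval (dY (dY c)) x y \<le> 0"
        using * by (simp add: mult_nonpos_nonneg)
      then have "hessdet c x y \<le> 0"
        unfolding hessdet_def dX_dY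
        using zero_le_square[of "peval (dY (dX c)) x y"] by linarith
      with * show False by simp
    qed
    then have "(x, y) \<notin> local_maxima c" using local_maxima_iff[of c x y, OF critical_points_simple] by blast
    then show ?thesis using False by auto
  qed
  then show ?thesis by auto
qed

text \<open>Besides the three axis points, each root g of G' carries two real points or none, as y^2
  = g^2 - w; \<open>generic\<close> excludes a double one.\<close>

lemma real_crits:
  "card (real_crits c) = 3 + 2 * card {g \<in> {g1, g2, g3}. w < g\<^sup>2}"
proof -
  define T where "T = {g1, g2, g3}"
  define S where "S = {g \<in> T. w < g\<^sup>2}"
  define A where "A = (\<lambda>a. (a, 0::real)) ` {a1, a2, a3}"
  define P where "P = (\<lambda>g. (g, sqrt (g\<^sup>2 - w))) ` S"
  define N where "N = (\<lambda>g. (g, - sqrt (g\<^sup>2 - w))) ` S"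
  have sq: "y\<^sup>2 = g\<^sup>2 - w \<longleftrightarrow> w < g\<^sup>2 \<and> (y = sqrt (g\<^sup>2 - w) \<or> y = - sqrt (g\<^sup>2 - w))"
    if "g \<in> T" for g y
  proof
    assume y: "y\<^sup>2 = g\<^sup>2 - w"
    then have "0 \<le> g\<^sup>2 - w" by (metis zero_le_power2)
    moreover have "g\<^sup>2 \<noteq> w" using that generic by (auto simp: T_def)
    ultimately have "w < g\<^sup>2" by simp
    moreover have "sqrt (g\<^sup>2 - w) = \<bar>y\<bar>" by (simp flip: y)
    ultimately show "w < g\<^sup>2 \<and> (y = sqrt (g\<^sup>2 - w) \<or> y = - sqrt (g\<^sup>2 - w))"
      by (simp add: abs_if)
  qed auto
  have "(x, y) \<in> real_crits c \<longleftrightarrow> (x, y) \<in> A \<union> (P \<union> N)" for x y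
  proof -
    have "(x, y) \<in> real_crits c \<longleftrightarrow> y = 0 \<and> x \<in> {a1, a2, a3} \<or> y\<^sup>2 = x\<^sup>2 - w \<and> x \<in> T"
      by (simp add: real_crits_def crit_cases T_def)
    also have "\<dots> \<longleftrightarrow> y = 0 \<and> x \<in> {a1, a2, a3}
        \<or> x \<in> S \<and> (y = sqrt (x\<^sup>2 - w) \<or> y = - sqrt (x\<^sup>2 - w))"
      using sq[of x y] by (auto simp: S_def)
    also have "\<dots> \<longleftrightarrow> (x, y) \<in> A \<union> (P \<union> N)" by (auto simp: A_def P_def N_def)
    finally show ?thesis .
  qed
  then have "real_crits c = A \<union> (P \<union> N)" by auto
  moreover have "finite A" "finite P" "finite N" by (simp_all add: A_def P_def N_def S_def T_def)
  moreover have "A \<inter> (P \<union> N) = {}" "P \<inter> N = {}" by (auto simp: A_def P_def N_def S_def)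
  ultimately have "card (real_crits c) = card A + (card P + card N)"
    by (simp only: card_Un_disjoint finite_Un)
  moreover have "card A = 3" using ordered by (simp add: A_def card_image inj_on_def)
  moreover have "card P = card S" "card N = card S"
    unfolding P_def N_def by (auto intro!: card_image inj_onI)
  ultimately show ?thesis by (simp add: S_def T_def)
qed

lemma realized: "realized (3 + 2 * card {g \<in> {g1, g2, g3}. w < g\<^sup>2}) (if w < a2\<^sup>2 then 1 else 0)"
  unfolding realized_def using morse four_lines real_crits local_maxima by (intro exI[of _ c]) simp

end

lemma Collect_insert_conj: "{x \<in> insert a A. P x} = (if P a then insert a {x \<in> A. P x} else {x \<in> A. P x})"
  by auto

lemma realized_examples:
  "realized 3 0" "realized 5 0" "realized 7 0" "realized 7 1" "realized 9 0" "realized 9 1"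
proof -
  \<comment> \<open>In each instance the number of \<open>g\<close> with g^2 > w is the number of
    extrema, and a2^2 > w decides whether there is a maximum. The condition on the triple products
    holds because 0 occurs in both triples, except in \<open>e90\<close>, where 6 times 10 balances
    60.\<close>
  interpret e30: symmetric_quartic "1/2" "5/2" "- 2" 0 2 "- 1" 0 1
    by unfold_locales (simp_all add: power2_eq_square)
  show "realized 3 0" using e30.realized unfolding Collect_insert_conj by (simp add: power2_eq_square)
  interpret e50: symmetric_quartic "1/2" 2 "- 1" 0 2 "- 2" 0 1
    by unfold_locales (simp_all add: power2_eq_square)
  show "realized 5 0" using e50.realized unfolding Collect_insert_conj by (simp add: power2_eq_square)
  interpret e70: symmetric_quartic "1/2" "5/2" "- 1" 0 1 "- 2" 0 2
    by unfold_locales (simp_all add: power2_eq_square)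
  show "realized 7 0" using e70.realized unfolding Collect_insert_conj by (simp add: power2_eq_square)
  interpret e71: symmetric_quartic "1/4" "1/4" 0 2 4 "- 3" 0 1
    by unfold_locales (simp_all add: power2_eq_square)
  show "realized 7 1" using e71.realized unfolding Collect_insert_conj by (simp add: power2_eq_square)
  interpret e90: symmetric_quartic "6/7" "31/7" "- 2" "- 1" 5 "- 5" "- 4" "- 3"
    by unfold_locales (simp_all add: power2_eq_square)
  show "realized 9 0" using e90.realized unfolding Collect_insert_conj by (simp add: power2_eq_square)
  interpret e91: symmetric_quartic "1/2" "- 2" 0 1 2 "- 2" "- 1" 0
    by unfold_locales (simp_all add: power2_eq_square)
  show "realized 9 1" using e91.realized unfolding Collect_insert_conj by (simp add: power2_eq_square)
qed

lemma realized_iff: "realized M m \<longleftrightarrow> (\<exists>n\<le>3. M = 2 * n + 3 \<and> m \<le> n)"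
proof
  assume "\<exists>n\<le>3. M = 2 * n + 3 \<and> m \<le> n"
  then obtain n where n: "n \<le> 3" "M = 2 * n + 3" "m \<le> n" by blast
  then have "n = 0 \<or> n = 1 \<or> n = 2 \<or> n = 3" "m = 0 \<or> m = 1 \<or> m = 2 \<or> m = 3" by linarith+
  with n have "(M, m) \<in> {(3, 0), (5, 0), (5, 1), (7, 0), (7, 1), (7, 2), (9, 0), (9, 1), (9, 2), (9, 3)}"
    by (elim disjE) simp_all
  \<comment> \<open>These four pairs are the mirror images, under passing from m to n - m, of pairs
    with at most one maximum.\<close>
  moreover have "realized 5 1" "realized 7 2" "realized 9 2" "realized 9 3"
    using realized_uminus[of 1 0] realized_uminus[of 2 0] realized_uminus[of 3 1] realized_uminus[of 3 0]
      realized_examples by simp_all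
  ultimately show "realized M m" using realized_examples by auto
qed (rule realized_bounds)

theorem theorem2:
  shows "{(card (real_crits c), card (local_maxima c)) | c. morse4 c \<and> four_real_lines c}
         = {(M, m). M \<in> {3, 5, 7, 9} \<and> real m < real M / 2 - 1}"
proof -
  \<comment> \<open>For M = 2 n + 3 the bound M / 2 - 1 is n + 1/2, so the strict inequality means m
    \<le> n.\<close>
  have "(\<exists>n\<le>3. M = 2 * n + 3 \<and> m \<le> n) \<longleftrightarrow> M \<in> {3, 5, 7, 9} \<and> real m < real M / 2 - 1" for M m :: nat
  proof
    assume "\<exists>n\<le>3. M = 2 * n + 3 \<and> m \<le> n"
    then obtain n where n: "n \<le> 3" "M = 2 * n + 3" "m \<le> n" by blast
    then have "n = 0 \<or> n = 1 \<or> n = 2 \<or> n = 3" by linarith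
    with n show "M \<in> {3, 5, 7, 9} \<and> real m < real M / 2 - 1" by auto
  next
    assume "M \<in> {3, 5, 7, 9} \<and> real m < real M / 2 - 1"
    then show "\<exists>n\<le>3. M = 2 * n + 3 \<and> m \<le> n"
      by (intro exI[of _ "(M - 3) div 2"]) auto
  qed
  then have "{(M, m). realized M m} = {(M, m). M \<in> {3, 5, 7, 9} \<and> real m < real M / 2 - 1}"
    by (simp only: realized_iff)
  moreover have "{(card (real_crits c), card (local_maxima c)) | c. morse4 c \<and> four_real_lines c}
      = {(M, m). realized M m}"
    unfolding realized_def by blast
  ultimately show ?thesis by simp
qed

end
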